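(* If the tree $T(o)=\{w_\beta\restriction\gamma:\gamma\le\beta<\omega_1\}$ is special, then Moore's space $\mathscr L=\{w_\beta:\beta<\omega_1\}\subseteq\mathcal S^{\omega_1}$ is not a $\Delta$-space.
   Context: Ordinals are identified with the set of smaller ordinals. A $C$-sequence is a sequence $\langle C_\alpha:\alpha<\omega_1\rangle$ with $C_0=\emptyset$, $C_{\beta+1}=\{\beta\}$, and, for each limit ordinal $\alpha>0$, $C_\alpha$ a cofinal subset of $\alpha$ such that $C_\alpha\cap\xi$ is finite for all $\xi<\alpha$. Fix an arbitrary $C$-sequence. Upper trace: for $\alpha\le\beta<\omega_1$, $U(\alpha,\alpha)=\emptyset$ and, for $\alpha<\beta$, $U(\alpha,\beta)=U(\alpha,\min(C_\beta\setminus\alpha))\cup\{\beta\}$. Lower trace: $L(\alpha,\alpha)=\emptyset$ and, for $\alpha<\beta$, $L(\alpha,\beta)=\big(L(\alpha,\min(C_\beta\setminus\alpha))\cup\{\max(C_\beta\cap\alpha)\}\big)\setminus\max(C_\beta\cap\alpha)$ if $C_\beta\cap\alpha\ne\emptyset$ (subtracting the ordinal $\max(C_\beta\cap\alpha)$ removes all elements smaller than it), and $L(\alpha,\beta)=L(\alpha,\min(C_\beta\setminus\alpha))$ if $C_\beta\cap\alpha=\emptyset$. For $\beta<\omega_1$ define $e_\beta:\beta\to\omega$ by $e_\beta(\alpha)=\max\{|C_\xi\cap\alpha|:\xi\in U(\alpha,\beta)\}$. For $\alpha<\beta<\omega_1$, $\operatorname{osc}(\alpha,\beta)$ is the number of $\zeta\in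 L(\alpha,\beta)\setminus\{\min L(\alpha,\beta)\}$ such that $e_\alpha(\zeta^{-})\le e_\beta(\zeta^{-})$ and $e_\alpha(\zeta)>e_\beta(\zeta)$, where $\zeta^{-}$ is the immediate predecessor of $\zeta$ in $L(\alpha,\beta)$ (so it is $0$ if $L(\alpha,\beta)=\emptyset$). Let $\mathcal S=\{z\in\mathbb C: z\overline z=1\}$, and fix a rationally independent family $\{z_\alpha:\alpha<\omega_1\}\subseteq\mathcal S$ (for distinct $\alpha_1,\dots,\alpha_k$ and integers $n_1,\dots,n_k$, $\prod_i z_{\alpha_i}^{n_i}=1$ only if all $n_i=0$). For $\alpha<\beta$ put $o(\alpha,\beta)=z_\alpha^{\operatorname{osc}(\alpha,\beta)+1}$. For $\beta<\omega_1$ let $w_\beta\in\mathcal S^{\omega_1}$ be given by $w_\beta(\alpha)=o(\alpha,\beta)$ if $\alpha<\beta$ and $w_\beta(\alpha)=1$ otherwise. $\mathscr L$ carries the subspace topology from the product $\mathcal S^{\omega_1}$. $T(o)$ is ordered by end-extension of functions; it is an Aronszajn tree. A tree of height $\omega_1$ is special if it is a union of countably many antichains (sets of pairwise incomparable elements). A topological space $X$ is a $\Delta$-space if for every decreasing sequence $\{D_n:n\in\omega\}$ of subsets of $X$ with $\bigcap_n D_n=\emptyset$ there is a decreasing sequence $\{U_n:n\in\omega\}$ of open subsets of $X$ with $U_n\supseteq D_n$ for all $n$ and $\bigcap_n U_n=\emptyset$. *)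

theory Defs
  imports "HOL-Analysis.Analysis" "HOL-Library.Countable_Set_Type"
begin

typedef omega1 = "Field (cardSuc natLeq)"
proof -
  have "Field (cardSuc natLeq) \<noteq> {}"
    using cardSuc_finite[OF natLeq_Card_order] Field_natLeq by fastforce
  then show ?thesis by blast
qed

instantiation omega1 :: wellorder
begin

definition less_eq_omega1 :: "omega1 \<Rightarrow> omega1 \<Rightarrow> bool" where
  "x \<le> y \<longleftrightarrow> (Rep_omega1 x, Rep_omega1 y) \<in> cardSuc natLeq"

definition less_omega1 :: "omega1 \<Rightarrow> omega1 \<Rightarrow> bool" where
  "x < y \<longleftrightarrow> x \<le> y \<and> x \<noteq> (y :: omega1)"

instance
proof -
  let ?r = "cardSuc natLeq"
  have wo: "Well_order ?r"
    using cardSuc_Card_order[OF natLeq_Card_order] by (simp add: card_order_on_def)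
  have rf: "refl_on (Field ?r) ?r" and tr: "trans ?r" and an: "antisym ?r"
    and tot: "total_on (Field ?r) ?r" and wfr: "wf (?r - Id)"
    using wo by (auto simp: well_order_on_def linear_order_on_def partial_order_on_def preorder_on_def)
  show "OFCLASS(omega1, wellorder_class)"
  proof intro_classes
    fix x y z :: omega1
    show le_refl: "x \<le> x"
      using rf Rep_omega1 by (auto simp: less_eq_omega1_def refl_on_def)
    show "x \<le> y \<Longrightarrow> y \<le> z \<Longrightarrow> x \<le> z"
      using tr by (auto simp: less_eq_omega1_def dest: transD)
    show anti: "x \<le> y \<Longrightarrow> y \<le> x \<Longrightarrow> x = y"
      using an by (auto simp: less_eq_omega1_def Rep_omega1_inject dest: antisymD)
    show "x < y \<longleftrightarrow> x \<le> y \<and> \<not> y \<le> x"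
      using anti le_refl by (auto simp: less_omega1_def)
    show "x \<le> y \<or> y \<le> x"
      using tot Rep_omega1[of x] Rep_omega1[of y] le_refl
      by (cases "x = y") (auto simp: less_eq_omega1_def total_on_def Rep_omega1_inject)
  next
    fix P :: "omega1 \<Rightarrow> bool" and a
    assume step: "\<And>x. (\<And>y. y < x \<Longrightarrow> P y) \<Longrightarrow> P x"
    have "wf (inv_image (?r - Id) Rep_omega1)"
      using wfr by simp
    then show "P a"
    proof (induction a rule: wf_induct_rule)
      case (less x)
      show ?case
        by (rule step, rule less)
          (auto simp: less_omega1_def less_eq_omega1_def in_inv_image Rep_omega1_inject)
    qed
  qed
qed

end

instantiation omega1 :: zero
begin

definition zero_omega1 :: omega1 where
  "0 = (LEAST x :: omega1. True)"

instance ..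

end

text \<open>Up to order isomorphism, \<^typ>\<open>omega1\<close> is the only uncountable well-order all of whose
  proper initial segments are countable.\<close>

lemma uncountable_omega1:
  includes cardinal_syntax
  shows "uncountable (UNIV :: omega1 set)"
proof
  assume "countable (UNIV :: omega1 set)"
  then have "countable (range Rep_omega1)" by simp
  then have "countable (Field (cardSuc natLeq))"
    using type_definition.Rep_range[OF type_definition_omega1] by simp
  then have "|Field (cardSuc natLeq)| \<le>o natLeq"
    by (meson card_of_nat countable_card_of_nat ordLeq_ordIso_trans)
  then have "cardSuc natLeq \<le>o natLeq"
    by (meson card_of_Field_ordIso cardSuc_Card_order natLeq_Card_order ordIso_ordLeq_trans
        ordIso_symmetric)
  then show False
    by (meson cardSuc_greater natLeq_Card_order not_ordLess_ordLeq)
qed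

lemma countable_lessThan_omega1:
  includes cardinal_syntax
  shows "countable {..<\<beta> :: omega1}"
proof -
  let ?r = "cardSuc natLeq"
  have "|underS ?r (Rep_omega1 \<beta>)| <o ?r"
    by (rule card_of_underS[OF cardSuc_Card_order[OF natLeq_Card_order] Rep_omega1])
  then have "|underS ?r (Rep_omega1 \<beta>)| \<le>o natLeq"
    by (simp add: cardSuc_ordLeq_ordLess natLeq_Card_order card_of_Card_order)
  then have "countable (underS ?r (Rep_omega1 \<beta>))"
    by (meson card_of_nat countable_card_of_nat ordIso_symmetric ordLeq_ordIso_trans)
  moreover have "Rep_omega1 ` {..<\<beta>} \<subseteq> underS ?r (Rep_omega1 \<beta>)"
    by (auto simp: less_omega1_def less_eq_omega1_def underS_def Rep_omega1_inject)
  ultimately have "countable (Rep_omega1 ` {..<\<beta>})"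
    using countable_subset by blast
  then show ?thesis
    by (rule countable_image_inj_on) (simp add: inj_on_def Rep_omega1_inject)
qed

lemma zero_le_omega1: "0 \<le> (\<beta> :: omega1)"
  unfolding zero_omega1_def by (rule Least_le) simp

definition succ1 :: "omega1 \<Rightarrow> omega1" where
  "succ1 \<beta> = (LEAST \<gamma>. \<beta> < \<gamma>)"

lemma less_succ1: "\<beta> < succ1 \<beta>"
proof -
  have "\<exists>\<gamma>. \<beta> < \<gamma>"
  proof (rule ccontr)
    assume "\<not> ?thesis"
    then have "UNIV = insert \<beta> {..<\<beta>}" by (auto simp: not_less_iff_gr_or_eq)
    then show False
      using uncountable_omega1 countable_lessThan_omega1[of \<beta>] by (metis countable_insert)
  qed
  then show ?thesis unfolding succ1_def by (rule LeastI_ex)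
qed

lemma lessThan_succ1: "{..<succ1 \<beta>} = {..\<beta>}"
  using less_succ1[of \<beta>] not_less_Least[of _ "\<lambda>\<gamma>. \<beta> < \<gamma>"]
  by (fastforce simp: succ1_def not_less)

definition limit1 :: "omega1 \<Rightarrow> bool" where
  "limit1 \<alpha> \<longleftrightarrow> \<alpha> \<noteq> 0 \<and> (\<forall>\<beta>. \<alpha> \<noteq> succ1 \<beta>)"

definition C_sequence :: "(omega1 \<Rightarrow> omega1 set) \<Rightarrow> bool" where
  "C_sequence C \<longleftrightarrow>
     C 0 = {} \<and>
     (\<forall>\<beta>. C (succ1 \<beta>) = {\<beta>}) \<and>
     (\<forall>\<alpha>. limit1 \<alpha> \<longrightarrow>
        C \<alpha> \<subseteq> {..<\<alpha>} \<and> (\<forall>\<xi><\<alpha>. \<exists>\<eta>\<in>C \<alpha>. \<xi> \<le> \<eta>) \<and> (\<forall>\<xi><\<alpha>. finite (C \<alpha> \<inter> {..<\<xi>})))"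

text \<open>The minimum of \<open>C\<^sub>\<beta> \<setminus> \<alpha>\<close>.\<close>

definition walk_step :: "(omega1 \<Rightarrow> omega1 set) \<Rightarrow> omega1 \<Rightarrow> omega1 \<Rightarrow> omega1" where
  "walk_step C \<alpha> \<beta> = (LEAST \<xi>. \<xi> \<in> C \<beta> - {..<\<alpha>})"

lemma C_sequence_subset:
  assumes "C_sequence C"
  shows "C \<beta> \<subseteq> {..<\<beta>}"
  using assms less_succ1 unfolding C_sequence_def limit1_def
  by (cases "\<beta> = 0"; cases "\<exists>\<gamma>. \<beta> = succ1 \<gamma>") auto

lemma C_sequence_cofinal:
  assumes "C_sequence C" "\<alpha> < \<beta>"
  shows "\<exists>\<xi>\<in>C \<beta>. \<alpha> \<le> \<xi>"
proof (cases "limit1 \<beta>")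
  case True
  then show ?thesis using assms unfolding C_sequence_def by blast
next
  case False
  have "\<beta> \<noteq> 0" using assms(2) zero_le_omega1[of \<alpha>] by auto
  with False obtain \<gamma> where \<gamma>: "\<beta> = succ1 \<gamma>" unfolding limit1_def by blast
  then have "\<alpha> \<le> \<gamma>" using assms(2) lessThan_succ1 by blast
  then show ?thesis using assms(1) \<gamma> unfolding C_sequence_def by auto
qed

lemma walk_step_in:
  assumes "C_sequence C" "\<alpha> < \<beta>"
  shows "walk_step C \<alpha> \<beta> \<in> C \<beta> - {..<\<alpha>}"
  unfolding walk_step_def
  by (rule LeastI_ex) (use C_sequence_cofinal[OF assms] in auto)

lemma walk_step_less:
  assumes "C_sequence C" "\<alpha> < \<beta>"
  shows "walk_step C \<alpha> \<beta> < \<beta>"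
  using walk_step_in[OF assms] C_sequence_subset[OF assms(1)] by blast

text \<open>The test \<open>walk_step C \<alpha> \<beta> < \<beta>\<close> in the two traces only serves termination: it is always
  true when \<open>C\<close> is a \<open>C\<close>-sequence and \<open>\<alpha> < \<beta>\<close>. The lemmas \<open>upper_trace_less\<close> and
  \<open>lower_trace_less\<close> give the recursions without it.\<close>

function upper_trace :: "(omega1 \<Rightarrow> omega1 set) \<Rightarrow> omega1 \<Rightarrow> omega1 \<Rightarrow> omega1 set" where
  "upper_trace C \<alpha> \<beta> =
     (if \<alpha> < \<beta> \<and> walk_step C \<alpha> \<beta> < \<beta>
      then upper_trace C \<alpha> (walk_step C \<alpha> \<beta>) \<union> {\<beta>}
      else {})"
  by auto
termination
  by (relation "inv_image {(x, y). x < y} (\<lambda>(C, \<alpha>, \<beta>). \<beta>)") (auto simp: wf)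

function lower_trace :: "(omega1 \<Rightarrow> omega1 set) \<Rightarrow> omega1 \<Rightarrow> omega1 \<Rightarrow> omega1 set" where
  "lower_trace C \<alpha> \<beta> =
     (if \<alpha> < \<beta> \<and> walk_step C \<alpha> \<beta> < \<beta>
      then if C \<beta> \<inter> {..<\<alpha>} \<noteq> {}
        then (lower_trace C \<alpha> (walk_step C \<alpha> \<beta>) \<union> {Max (C \<beta> \<inter> {..<\<alpha>})})
               - {..<Max (C \<beta> \<inter> {..<\<alpha>})}
        else lower_trace C \<alpha> (walk_step C \<alpha> \<beta>)
      else {})"
  by auto
termination
  by (relation "inv_image {(x, y). x < y} (\<lambda>(C, \<alpha>, \<beta>). \<beta>)") (auto simp: wf)

declare upper_trace.simps [simp del] lower_trace.simps [simp del]

lemma upper_trace_same: "upper_trace C \<alpha> \<alpha> = {}"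
  by (simp add: upper_trace.simps)

lemma upper_trace_less:
  assumes "C_sequence C" "\<alpha> < \<beta>"
  shows "upper_trace C \<alpha> \<beta> = upper_trace C \<alpha> (walk_step C \<alpha> \<beta>) \<union> {\<beta>}"
  using assms walk_step_less[OF assms] by (subst upper_trace.simps) simp

lemma lower_trace_same: "lower_trace C \<alpha> \<alpha> = {}"
  by (simp add: lower_trace.simps)

lemma lower_trace_less:
  assumes "C_sequence C" "\<alpha> < \<beta>"
  shows "lower_trace C \<alpha> \<beta> =
     (if C \<beta> \<inter> {..<\<alpha>} \<noteq> {}
      then (lower_trace C \<alpha> (walk_step C \<alpha> \<beta>) \<union> {Max (C \<beta> \<inter> {..<\<alpha>})})
             - {..<Max (C \<beta> \<inter> {..<\<alpha>})}
      else lower_trace C \<alpha> (walk_step C \<alpha> \<beta>))"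
  using assms walk_step_less[OF assms] by (subst lower_trace.simps) simp

text \<open>\<open>walk_e C \<beta>\<close> is the function \<open>e\<^sub>\<beta>\<close>; only its values on arguments below \<open>\<beta>\<close> are meaningful.\<close>

definition walk_e :: "(omega1 \<Rightarrow> omega1 set) \<Rightarrow> omega1 \<Rightarrow> omega1 \<Rightarrow> nat" where
  "walk_e C \<beta> \<alpha> = Max ((\<lambda>\<xi>. card (C \<xi> \<inter> {..<\<alpha>})) ` upper_trace C \<alpha> \<beta>)"

definition osc :: "(omega1 \<Rightarrow> omega1 set) \<Rightarrow> omega1 \<Rightarrow> omega1 \<Rightarrow> nat" where
  "osc C \<alpha> \<beta> =
     (let L = lower_trace C \<alpha> \<beta>; pred = (\<lambda>\<zeta>. Max (L \<inter> {..<\<zeta>})) in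
      card {\<zeta> \<in> L - {Min L}.
              walk_e C \<alpha> (pred \<zeta>) \<le> walk_e C \<beta> (pred \<zeta>) \<and> walk_e C \<alpha> \<zeta> > walk_e C \<beta> \<zeta>})"

definition unit_circle :: "complex set" where
  "unit_circle = {z. z * cnj z = 1}"

definition rationally_independent :: "(omega1 \<Rightarrow> complex) \<Rightarrow> bool" where
  "rationally_independent z \<longleftrightarrow>
     (\<forall>F (n :: omega1 \<Rightarrow> int). finite F \<longrightarrow> (\<Prod>\<alpha>\<in>F. z \<alpha> powi n \<alpha>) = 1 \<longrightarrow> (\<forall>\<alpha>\<in>F. n \<alpha> = 0))"

definition osc_col :: "(omega1 \<Rightarrow> omega1 set) \<Rightarrow> (omega1 \<Rightarrow> complex) \<Rightarrow> omega1 \<Rightarrow> omega1 \<Rightarrow> complex" where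
  "osc_col C z \<alpha> \<beta> = z \<alpha> ^ (osc C \<alpha> \<beta> + 1)"

definition moore_w :: "(omega1 \<Rightarrow> omega1 set) \<Rightarrow> (omega1 \<Rightarrow> complex) \<Rightarrow> omega1 \<Rightarrow> omega1 \<Rightarrow> complex" where
  "moore_w C z \<beta> \<alpha> = (if \<alpha> < \<beta> then osc_col C z \<alpha> \<beta> else 1)"

definition moore_space :: "(omega1 \<Rightarrow> omega1 set) \<Rightarrow> (omega1 \<Rightarrow> complex) \<Rightarrow> (omega1 \<Rightarrow> complex) topology" where
  "moore_space C z =
     subtopology (product_topology (\<lambda>_. top_of_set unit_circle) UNIV) (range (moore_w C z))"

lemma moore_w_in_unit_circle:
  assumes "range z \<subseteq> unit_circle"
  shows "moore_w C z \<beta> \<alpha> \<in> unit_circle"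
proof -
  have "z \<alpha> ^ k * cnj (z \<alpha> ^ k) = (z \<alpha> * cnj (z \<alpha>)) ^ k" for k
    by (simp add: power_mult_distrib)
  moreover have "z \<alpha> * cnj (z \<alpha>) = 1"
    using assms by (auto simp: unit_circle_def)
  ultimately show ?thesis
    by (simp add: moore_w_def osc_col_def unit_circle_def del: power_Suc)
qed

lemma topspace_moore_space:
  assumes "range z \<subseteq> unit_circle"
  shows "topspace (moore_space C z) = range (moore_w C z)"
  using moore_w_in_unit_circle[OF assms] by (auto simp: moore_space_def)

text \<open>The restriction of \<open>w\<^sub>\<beta>\<close> to \<open>\<gamma>\<close> is the partial function with domain \<open>{..<\<gamma>}\<close>. All elements
  of the tree have initial segments of \<^typ>\<open>omega1\<close> as domains, so end-extension is \<open>(\<subseteq>\<^sub>m)\<close>.\<close>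

definition moore_tree :: "(omega1 \<Rightarrow> omega1 set) \<Rightarrow> (omega1 \<Rightarrow> complex) \<Rightarrow> (omega1 \<rightharpoonup> complex) set" where
  "moore_tree C z = {(Some \<circ> moore_w C z \<beta>) |` {..<\<gamma>} | \<beta> \<gamma>. \<gamma> \<le> \<beta>}"

definition order_antichain :: "('a \<Rightarrow> 'a \<Rightarrow> bool) \<Rightarrow> 'a set \<Rightarrow> bool" where
  "order_antichain le A \<longleftrightarrow> (\<forall>s\<in>A. \<forall>t\<in>A. s \<noteq> t \<longrightarrow> \<not> le s t \<and> \<not> le t s)"

definition special_tree :: "('a \<Rightarrow> 'a \<Rightarrow> bool) \<Rightarrow> 'a set \<Rightarrow> bool" where
  "special_tree le T \<longleftrightarrow> (\<exists>A :: nat \<Rightarrow> 'a set. (\<forall>n. order_antichain le (A n)) \<and> T = (\<Union>n. A n))"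

definition Delta_space :: "'a topology \<Rightarrow> bool" where
  "Delta_space X \<longleftrightarrow>
     (\<forall>D :: nat \<Rightarrow> 'a set.
        (\<forall>n. D n \<subseteq> topspace X) \<and> decseq D \<and> (\<Inter>n. D n) = {} \<longrightarrow>
        (\<exists>U :: nat \<Rightarrow> 'a set.
           (\<forall>n. openin X (U n)) \<and> decseq U \<and> (\<forall>n. D n \<subseteq> U n) \<and> (\<Inter>n. U n) = {}))"

end

theory Submission
  imports Defs
begin

text \<open>
Write \<open>w\<^sub>\<beta>\<close> for the points of Moore's space and call the set of all \<open>\<delta>\<close> for which \<open>w\<^sub>\<delta>\<close> agrees
with \<open>w\<^sub>\<beta>\<close> below \<open>\<gamma>\<close> a cone of level \<open>\<gamma>\<close>.

The space refutes the \<open>\<Delta>\<close> property because it combines two features. It is hereditarily Lindelof: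
if every \<open>w\<^sub>\<beta>\<close> with \<open>\<beta> \<in> Y\<close> has a basic neighbourhood, then countably many of these neighbourhoods
cover all these points (\<open>countable_subcover\<close>). And each level has an uncountable cone, since only
countably many functions are restrictions to \<open>\<gamma>\<close> of some \<open>w\<^sub>\<beta>\<close> with \<open>\<gamma> \<le> \<beta>\<close> (\<open>uncountable_cone\<close>).
There are only \<open>\<aleph>\<^sub>1\<close> cones, so a diagonal construction gives \<open>f : \<omega>\<^sub>1 \<rightarrow> \<omega>\<close> unbounded on each uncountable
cone (\<open>ex_unbounded_on_uncountable_sets\<close>). Put \<open>D\<^sub>n = {w\<^sub>\<beta> : f(\<beta>) \<ge> n}\<close>; the sets \<open>D\<^sub>n\<close> have empty
intersection. If \<open>U\<^sub>n \<supseteq> D\<^sub>n\<close> are open, then \<open>D\<^sub>n\<close> is covered by countably many basic open subsets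
of \<open>U\<^sub>n\<close>. All of these, for all \<open>n\<close> together, look only at coordinates below one countable \<open>\<gamma>\<close>, so
whether a point belongs to their union for \<open>n\<close> depends only on its cone of level \<open>\<gamma>\<close>. An uncountable
cone of level \<open>\<gamma>\<close> contains points of every \<open>D\<^sub>n\<close>; hence all its points lie in every \<open>U\<^sub>n\<close>.

The Lindelof property is Moore's theorem. A failure would give a sequence of points of length
\<open>\<omega>\<^sub>1\<close> with basic neighbourhoods such that no point lies in the neighbourhood of an earlier one. After thinning
out, the finite supports of these neighbourhoods consist of a common root, on which all the points are close
to each other, and of petals that tend to \<open>\<omega>\<^sub>1\<close>. By \<open>oscillation_attains_shifts\<close> there are a petal and
later points for which the oscillations with all elements of the petal run simultaneously through
arbitrarily many consecutive values. As \<open>w\<^sub>\<delta>(\<alpha>)\<close> is a power of \<open>z\<^sub>\<alpha>\<close> whose exponent is governed by the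
oscillation, Kronecker's theorem (\<open>Kronecker_circle_uniform\<close>) makes one of these points land in the
neighbourhood.

The oscillation theorem in turn needs that the functions \<open>e\<^sub>\<beta>\<close> are finite-to-one and coherent, and that
lower traces concatenate (\<open>L_concat\<close>). A limit \<open>\<delta>\<close> is taken that reflects the relevant
properties of the families, in place of a countable elementary submodel. Each property that holds at
\<open>\<delta>\<close> then holds at some larger \<open>\<delta>'\<close>, and inserting the detour through \<open>\<delta>'\<close> prolongs \<open>L(\<delta>, b)\<close> by a
nonempty block on which \<open>e\<^sub>a = e\<^sub>b\<close> (\<open>extend_equal\<close>) or \<open>e\<^sub>a > e\<^sub>b\<close> (\<open>extend_greater\<close>), for all \<open>a\<close> of
a petal at once. A block of each kind raises all the oscillations by exactly one.
\<close>

section \<open>Countable and uncountable sets of ordinals below omega-one\<close>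

lemma countable_bounded_omega1:
  fixes A :: "omega1 set"
  assumes "countable A"
  obtains b where "\<And>a. a \<in> A \<Longrightarrow> a < b"
proof -
  have "\<exists>b. \<forall>a\<in>A. a < b"
  proof (rule ccontr)
    assume "\<not> ?thesis"
    then have "UNIV \<subseteq> (\<Union>a\<in>A. {..<succ1 a})"
      using lessThan_succ1 by (fastforce simp: not_less)
    moreover have "countable (\<Union>a\<in>A. {..<succ1 a})"
      using assms countable_lessThan_omega1 by blast
    ultimately show False
      using uncountable_omega1 countable_subset by blast
  qed
  then show thesis using that by blast
qed

lemma countable_atMost_omega1: "countable {..b :: omega1}"
  using countable_lessThan_omega1[of "succ1 b"] by (simp add: lessThan_succ1)

lemma bounded_countable_omega1:
  fixes A :: "omega1 set"
  assumes "\<And>a. a \<in> A \<Longrightarrow> a \<le> b"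
  shows "countable A"
  by (rule countable_subset[OF _ countable_atMost_omega1[of b]]) (use assms in auto)

lemma uncountable_unbounded_omega1:
  fixes A :: "omega1 set"
  assumes "uncountable A"
  obtains a where "a \<in> A" "b < a"
  using assms bounded_countable_omega1[of A b] by (meson not_le)

lemma uncountable_cofinal_omega1:
  fixes A :: "omega1 set"
  assumes "\<And>b. \<exists>a\<in>A. b \<le> a"
  shows "uncountable A"
  using assms countable_bounded_omega1 by (metis not_le)

lemma uncountable_fiber:
  assumes "uncountable X" "countable (f ` X)"
  obtains v where "uncountable {x \<in> X. f x = v}"
proof -
  have "X = (\<Union>v\<in>f ` X. {x \<in> X. f x = v})" by auto
  then show thesis
    using assms that by (metis (no_types, lifting) countable_UN)
qed

lemma uncountable_minus_countable_nonempty: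
  assumes "uncountable X" "countable (X - Y)"
  shows "uncountable (X \<inter> Y)"
  using assms by (metis Int_Diff_Un countable_Un)

text \<open>Closing off under a countable-valued operation. Encoding the sets definable from parameters below
  \<open>\<nu>\<close> in \<open>H \<nu>\<close>, such a \<open>\<delta>\<close> behaves like the trace on \<open>\<omega>\<^sub>1\<close> of a countable elementary submodel.\<close>

lemma limit_closed_under:
  fixes H :: "omega1 \<Rightarrow> omega1 set"
  assumes H: "\<And>\<nu>. countable (H \<nu>)"
  obtains \<delta> where "limit1 \<delta>" "\<nu>0 < \<delta>" "\<And>\<nu> \<eta>. \<nu> < \<delta> \<Longrightarrow> \<eta> \<in> H \<nu> \<Longrightarrow> \<eta> < \<delta>"
proof -
  have "\<exists>b. x < b \<and> (\<forall>\<nu>\<le>x. \<forall>\<eta>\<in>H \<nu>. \<eta> < b)" for x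
  proof -
    have "countable (insert x (\<Union>\<nu>\<in>{..x}. H \<nu>))"
      using H countable_atMost_omega1 by auto
    then show ?thesis by (rule countable_bounded_omega1) auto
  qed
  then obtain s where s: "\<And>x. x < s x" "\<And>x \<nu> \<eta>. \<nu> \<le> x \<Longrightarrow> \<eta> \<in> H \<nu> \<Longrightarrow> \<eta> < s x"
    by metis
  define h where "h n = (s ^^ n) \<nu>0" for n
  have hSuc: "h (Suc n) = s (h n)" for n by (simp add: h_def)
  define \<delta> where "\<delta> = (LEAST d. \<forall>n. h n < d)"
  have "countable (range h)" by simp
  then have "\<exists>d. \<forall>n. h n < d" by (rule countable_bounded_omega1) auto
  then have h: "h n < \<delta>" for n
    unfolding \<delta>_def by (rule LeastI2_ex) auto
  have cof: "\<exists>n. \<nu> \<le> h n" if "\<nu> < \<delta>" for \<nu>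
    using not_less_Least[OF that[unfolded \<delta>_def]] by (auto simp: not_less)
  show thesis
  proof (rule that)
    show "\<nu>0 < \<delta>" using h[of 0] by (simp add: h_def)
    then have "\<delta> \<noteq> 0" using zero_le_omega1[of \<nu>0] by auto
    moreover have "\<delta> \<noteq> succ1 \<beta>" for \<beta>
    proof
      assume \<delta>: "\<delta> = succ1 \<beta>"
      then obtain n where "\<beta> \<le> h n" using cof less_succ1 by blast
      then have "\<beta> < h (Suc n)" using s(1)[of "h n"] hSuc by (metis order_le_less_trans)
      moreover have "h (Suc n) \<in> {..<succ1 \<beta>}" using h \<delta> by auto
      ultimately show False by (simp add: lessThan_succ1)
    qed
    ultimately show "limit1 \<delta>" by (simp add: limit1_def)
    show "\<eta> < \<delta>" if "\<nu> < \<delta>" "\<eta> \<in> H \<nu>" for \<nu> \<eta>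
      using cof[OF that(1)] s(2) that(2) h hSuc by (metis order_less_trans)
  qed
qed

lemma limit_bound_finite:
  assumes "limit1 \<delta>" "finite S" "S \<subseteq> {..<\<delta>}"
  obtains \<nu> where "\<nu> < \<delta>" "\<And>x. x \<in> S \<Longrightarrow> x < \<nu>"
proof (cases "S = {}")
  case True
  have "0 < \<delta>" using assms(1) zero_le_omega1[of \<delta>] by (auto simp: limit1_def order.order_iff_strict)
  then show ?thesis using True that by blast
next
  case False
  have "Max S \<in> {..<\<delta>}" using Max_in[OF assms(2) False] assms(3) by blast
  moreover have "succ1 (Max S) \<le> \<delta>"
    using \<open>Max S \<in> _\<close> lessThan_succ1[of "Max S"] by (metis lessThan_iff atMost_iff not_le order_le_less_trans less_irrefl)
  ultimately have "succ1 (Max S) < \<delta>" using assms(1) by (metis limit1_def order.order_iff_strict)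
  moreover have "x < succ1 (Max S)" if "x \<in> S" for x
    using that Max_ge[OF assms(2)] less_succ1 order_le_less_trans by blast
  ultimately show ?thesis using that by blast
qed

section \<open>Walks along a C-sequence\<close>

locale ladder_system =
  fixes C :: "omega1 \<Rightarrow> omega1 set"
  assumes C_sequence: "C_sequence C"
begin

abbreviation "step \<equiv> walk_step C"
abbreviation "L \<equiv> lower_trace C"
abbreviation "e \<equiv> walk_e C"

lemma C_less: "\<xi> \<in> C \<beta> \<Longrightarrow> \<xi> < \<beta>"
  using C_sequence_subset[OF C_sequence] by blast

lemma finite_C_below:
  assumes "\<alpha> < \<beta>"
  shows "finite (C \<beta> \<inter> {..<\<alpha>})"
proof (cases "limit1 \<beta>")
  case True
  then show ?thesis using C_sequence assms unfolding C_sequence_def by blast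
next
  case False
  have "\<beta> \<noteq> 0" using assms zero_le_omega1[of \<alpha>] by auto
  with False obtain \<gamma> where "\<beta> = succ1 \<gamma>" unfolding limit1_def by blast
  then show ?thesis using C_sequence unfolding C_sequence_def by auto
qed

lemma C_cofinal: "limit1 \<delta> \<Longrightarrow> \<nu> < \<delta> \<Longrightarrow> \<exists>m\<in>C \<delta>. \<nu> \<le> m"
  using C_sequence unfolding C_sequence_def by blast

lemma step:
  assumes "\<alpha> < \<beta>"
  shows "step \<alpha> \<beta> \<in> C \<beta>" "\<alpha> \<le> step \<alpha> \<beta>" "step \<alpha> \<beta> < \<beta>"
  using walk_step_in[OF C_sequence assms] walk_step_less[OF C_sequence assms] by auto

lemma step_le: "\<xi> \<in> C \<beta> \<Longrightarrow> \<alpha> \<le> \<xi> \<Longrightarrow> step \<alpha> \<beta> \<le> \<xi>"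
  unfolding walk_step_def by (rule Least_le) auto

lemma C_below_step:
  assumes "\<alpha> < \<beta>"
  shows "C \<beta> \<inter> {..<step \<alpha> \<beta>} = C \<beta> \<inter> {..<\<alpha>}"
  using step_le[of _ \<beta> \<alpha>] step(2)[OF assms] by (auto simp: not_le[symmetric])

lemma step_eqI:
  assumes "\<alpha> \<le> \<gamma>" "\<gamma> < \<beta>" "\<gamma> \<le> step \<alpha> \<beta>"
  shows "step \<alpha> \<beta> = step \<gamma> \<beta>"
proof (rule antisym)
  show "step \<alpha> \<beta> \<le> step \<gamma> \<beta>"
    using step[OF assms(2)] assms(1) by (intro step_le) auto
  show "step \<gamma> \<beta> \<le> step \<alpha> \<beta>"
    using step[of \<alpha> \<beta>] assms by (intro step_le) auto
qed

lemma upper_trace_props: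
  "finite (upper_trace C \<alpha> \<beta>)" "\<xi> \<in> upper_trace C \<alpha> \<beta> \<Longrightarrow> \<alpha> < \<xi>"
proof (induction \<beta> rule: less_induct)
  case (less \<beta>)
  { case 1 then show ?case using less step(3)[of \<alpha> \<beta>]
      by (cases "\<alpha> < \<beta>") (auto simp: upper_trace_less[OF C_sequence] upper_trace.simps[of C \<alpha> \<beta>]) }
  { case 2 then show ?case using less step(3)[of \<alpha> \<beta>]
      by (cases "\<alpha> < \<beta>") (auto simp: upper_trace_less[OF C_sequence] upper_trace.simps[of C \<alpha> \<beta>]) }
qed

text \<open>The case distinction is needed because \<open>e\<^sub>\<alpha>(\<alpha>)\<close> is a maximum over the empty set, hence arbitrary.\<close>

lemma e_step:
  assumes "\<alpha> < \<beta>"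
  shows "e \<beta> \<alpha> = (if step \<alpha> \<beta> = \<alpha> then card (C \<beta> \<inter> {..<\<alpha>})
                  else max (card (C \<beta> \<inter> {..<\<alpha>})) (e (step \<alpha> \<beta>) \<alpha>))"
proof (cases "step \<alpha> \<beta> = \<alpha>")
  case True
  then show ?thesis
    using upper_trace_less[OF C_sequence assms] by (simp add: walk_e_def upper_trace_same)
next
  case False
  then have "\<alpha> < step \<alpha> \<beta>" using step[OF assms] by auto
  then have "upper_trace C \<alpha> (step \<alpha> \<beta>) \<noteq> {}"
    using upper_trace_less[OF C_sequence] by auto
  then show ?thesis
    using upper_trace_less[OF C_sequence assms] False
    by (simp add: walk_e_def upper_trace_props)
qed

lemma L_subset: "L \<alpha> \<beta> \<subseteq> {..<\<alpha>}"
proof (induction \<beta> rule: less_induct)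
  case (less \<beta>)
  show ?case
  proof (cases "\<alpha> < \<beta>")
    case True
    have "Max (C \<beta> \<inter> {..<\<alpha>}) \<in> C \<beta> \<inter> {..<\<alpha>}" if "C \<beta> \<inter> {..<\<alpha>} \<noteq> {}"
      using Max_in[OF finite_C_below[OF True] that] .
    then show ?thesis
      using less[OF step(3)[OF True]] unfolding lower_trace_less[OF C_sequence True]
      by auto
  qed (simp add: lower_trace.simps)
qed

lemma finite_L: "finite (L \<alpha> \<beta>)"
proof (induction \<beta> rule: less_induct)
  case (less \<beta>)
  show ?case
    using less[OF step(3)] by (cases "\<alpha> < \<beta>")
     (simp_all add: lower_trace_less[OF C_sequence] lower_trace.simps[of C \<alpha> \<beta>])
qed

text \<open>A point of \<open>C \<beta>\<close> just below \<open>\<alpha>\<close> truncates the lower trace. This is how lower traces are pushed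
  above a prescribed bound.\<close>

lemma L_ge:
  assumes "\<alpha> < \<beta>" "m \<in> C \<beta>" "m < \<alpha>"
  shows "L \<alpha> \<beta> \<noteq> {}" "\<xi> \<in> L \<alpha> \<beta> \<Longrightarrow> m \<le> \<xi>"
proof -
  have "C \<beta> \<inter> {..<\<alpha>} \<noteq> {}" "m \<le> Max (C \<beta> \<inter> {..<\<alpha>})"
    using assms finite_C_below[OF assms(1)] by (auto intro: Max_ge)
  then show "L \<alpha> \<beta> \<noteq> {}" "\<xi> \<in> L \<alpha> \<beta> \<Longrightarrow> m \<le> \<xi>"
    unfolding lower_trace_less[OF C_sequence assms(1)] by auto
qed

text \<open>Under the hypotheses the walk from \<open>\<gamma>\<close> to \<open>\<alpha>\<close> passes through \<open>\<beta>\<close>: since \<open>max (C \<gamma> \<inter> \<beta>)\<close> belongs to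
  \<open>L \<beta> \<gamma>\<close>, it lies below \<open>\<alpha>\<close>, so \<open>C \<gamma>\<close> has no point in \<open>[\<alpha>, \<beta>)\<close> and the first steps towards \<open>\<alpha>\<close> and
  towards \<open>\<beta>\<close> coincide.\<close>

lemma L_concat:
  assumes "\<alpha> \<le> \<beta>" "\<beta> \<le> \<gamma>" "\<And>x. x \<in> L \<beta> \<gamma> \<Longrightarrow> x < \<alpha>"
    "\<And>x y. x \<in> L \<beta> \<gamma> \<Longrightarrow> y \<in> L \<alpha> \<beta> \<Longrightarrow> x < y"
  shows "L \<alpha> \<gamma> = L \<alpha> \<beta> \<union> L \<beta> \<gamma>"
  using assms(2-4)
proof (induction \<gamma> rule: less_induct)
  case (less \<gamma>)
  show ?case
  proof (cases "\<beta> = \<gamma>")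
    case True
    then show ?thesis by (simp add: lower_trace_same)
  next
    case False
    then have \<beta>\<gamma>: "\<beta> < \<gamma>" using less.prems by auto
    then have \<alpha>\<gamma>: "\<alpha> < \<gamma>" using assms(1) by auto
    let ?\<eta> = "step \<beta> \<gamma>" and ?m = "Max (C \<gamma> \<inter> {..<\<beta>})"
    note fin = finite_C_below[OF \<beta>\<gamma>]
    note L\<beta> = lower_trace_less[OF C_sequence \<beta>\<gamma>]
    have m: "?m \<in> L \<beta> \<gamma>" "?m \<in> C \<gamma> \<inter> {..<\<beta>}" if "C \<gamma> \<inter> {..<\<beta>} \<noteq> {}"
      using that Max_in[OF fin] unfolding L\<beta> by auto
    have below: "x < \<alpha>" if "x \<in> C \<gamma>" "x < \<beta>" for x
    proof -
      have "C \<gamma> \<inter> {..<\<beta>} \<noteq> {}" "x \<le> ?m"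
        using that fin by (auto intro: Max_ge)
      then show ?thesis using less.prems(2) m(1) by fastforce
    qed
    then have CI: "C \<gamma> \<inter> {..<\<alpha>} = C \<gamma> \<inter> {..<\<beta>}" using assms(1) by auto
    have "\<beta> \<le> step \<alpha> \<gamma>"
      using below step(1,2)[OF \<alpha>\<gamma>] by (meson not_le leD)
    then have \<eta>: "step \<alpha> \<gamma> = ?\<eta>"
      by (intro step_eqI assms(1) \<beta>\<gamma>)
    have sub: "x \<in> L \<beta> \<gamma> \<or> (C \<gamma> \<inter> {..<\<beta>} \<noteq> {} \<and> x < ?m)" if "x \<in> L \<beta> ?\<eta>" for x
      using that unfolding L\<beta> by auto
    have IH: "L \<alpha> ?\<eta> = L \<alpha> \<beta> \<union> L \<beta> ?\<eta>"
    proof (rule less.IH)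
      show "?\<eta> < \<gamma>" "\<beta> \<le> ?\<eta>" using step[OF \<beta>\<gamma>] by auto
      show "x < \<alpha>" if "x \<in> L \<beta> ?\<eta>" for x
        using sub[OF that] less.prems(2) m by (meson order_less_trans)
      show "x < y" if "x \<in> L \<beta> ?\<eta>" "y \<in> L \<alpha> \<beta>" for x y
        using sub[OF that(1)] that(2) less.prems(3) m by (meson order_less_trans)
    qed
    have "\<not> y < ?m" if "y \<in> L \<alpha> \<beta>" "C \<gamma> \<inter> {..<\<beta>} \<noteq> {}" for y
      using less.prems(3) m(1) that by (meson not_less_iff_gr_or_eq)
    then show ?thesis
      unfolding lower_trace_less[OF C_sequence \<alpha>\<gamma>] L\<beta> CI \<eta> IH
      by auto
  qed
qed

lemma finite_short_initial_C: "finite {\<eta> \<in> C \<beta>. card (C \<beta> \<inter> {..<\<eta>}) \<le> n}" (is "finite ?F")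
proof (rule ccontr)
  assume "infinite ?F"
  then obtain G where G: "G \<subseteq> ?F" "finite G" "card G = n + 2"
    using infinite_arbitrarily_large by blast
  then have "G \<noteq> {}" by auto
  then have M: "Max G \<in> G" using G by simp
  then have fin: "finite (C \<beta> \<inter> {..<Max G})"
    using G(1) C_less finite_C_below by blast
  have "G - {Max G} \<subseteq> C \<beta> \<inter> {..<Max G}"
    using G Max_ge[OF G(2)] by (auto simp: order.strict_iff_order)
  then have "card (G - {Max G}) \<le> card (C \<beta> \<inter> {..<Max G})"
    using fin card_mono by blast
  then have "n + 1 \<le> card (C \<beta> \<inter> {..<Max G})" using G M by simp
  then show False using M G by auto
qed

text \<open>If \<open>e\<^sub>\<beta>(\<alpha>) \<le> n\<close> then the first step of the walk goes to one of the first \<open>n + 1\<close> elements \<open>\<eta>\<close> of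
  \<open>C \<beta>\<close>, and \<open>e\<^sub>\<eta>(\<alpha>) \<le> n\<close> unless \<open>\<alpha> = \<eta>\<close>; so induction on \<open>\<beta>\<close> applies to finitely many \<open>\<eta>\<close>.\<close>

lemma e_finite_to_one: "finite {\<alpha>. \<alpha> < \<beta> \<and> e \<beta> \<alpha> \<le> n}"
proof (induction \<beta> rule: less_induct)
  case (less \<beta>)
  let ?F = "{\<eta> \<in> C \<beta>. card (C \<beta> \<inter> {..<\<eta>}) \<le> n}"
  have "{\<alpha>. \<alpha> < \<beta> \<and> e \<beta> \<alpha> \<le> n} \<subseteq> (\<Union>\<eta>\<in>?F. insert \<eta> {\<alpha>. \<alpha> < \<eta> \<and> e \<eta> \<alpha> \<le> n})"
  proof
    fix \<alpha> assume "\<alpha> \<in> {\<alpha>. \<alpha> < \<beta> \<and> e \<beta> \<alpha> \<le> n}"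
    then have \<alpha>: "\<alpha> < \<beta>" "e \<beta> \<alpha> \<le> n" by auto
    have "card (C \<beta> \<inter> {..<step \<alpha> \<beta>}) \<le> n" "step \<alpha> \<beta> = \<alpha> \<or> e (step \<alpha> \<beta>) \<alpha> \<le> n"
      using \<alpha>(2) unfolding e_step[OF \<alpha>(1)] C_below_step[OF \<alpha>(1)] by (auto split: if_splits)
    then show "\<alpha> \<in> (\<Union>\<eta>\<in>?F. insert \<eta> {\<alpha>. \<alpha> < \<eta> \<and> e \<eta> \<alpha> \<le> n})"
      using step[OF \<alpha>(1)] by (intro UN_I[of "step \<alpha> \<beta>"]) auto
  qed
  moreover have "finite (\<Union>\<eta>\<in>?F. insert \<eta> {\<alpha>. \<alpha> < \<eta> \<and> e \<eta> \<alpha> \<le> n})"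
    using less C_less finite_short_initial_C by auto
  ultimately show ?case by (rule finite_subset)
qed

lemma e_coherent:
  assumes "\<gamma> < \<beta>"
  shows "finite {\<alpha>. \<alpha> < \<gamma> \<and> e \<gamma> \<alpha> \<noteq> e \<beta> \<alpha>}"
  using assms
proof (induction \<beta> arbitrary: \<gamma> rule: less_induct)
  case (less \<beta>)
  let ?D = "\<lambda>\<gamma> \<beta>. {\<alpha>. \<alpha> < \<gamma> \<and> \<alpha> < \<beta> \<and> e \<gamma> \<alpha> \<noteq> e \<beta> \<alpha>}"
  let ?F = "insert (step \<gamma> \<beta>) (C \<beta> \<inter> {..<\<gamma>})"
  have D: "finite (?D \<eta> \<gamma>)" if "\<eta> < \<beta>" for \<eta>
  proof (cases \<eta> \<gamma> rule: linorder_cases)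
    case less
    then show ?thesis using less.IH[OF \<open>\<gamma> < \<beta>\<close> less]
      by (rule_tac finite_subset[rotated]) auto
  next
    case equal
    then show ?thesis by simp
  next
    case greater
    then show ?thesis using less.IH[OF that greater]
      by (rule_tac finite_subset[rotated]) auto
  qed
  \<comment> \<open>The first step goes to some \<open>\<eta>\<close> in the finite set \<open>?F\<close>. Outside a finite set, \<open>e \<eta>\<close> agrees
      with \<open>e \<gamma>\<close> and exceeds the constant that \<open>C \<beta>\<close> contributes, so the maximum is \<open>e \<gamma>\<close>.\<close>
  have "{\<alpha>. \<alpha> < \<gamma> \<and> e \<gamma> \<alpha> \<noteq> e \<beta> \<alpha>} \<subseteq>
     (\<Union>\<eta>\<in>?F. insert \<eta> (?D \<eta> \<gamma> \<union> {\<alpha>. \<alpha> < \<eta> \<and> e \<eta> \<alpha> \<le> card (C \<beta> \<inter> {..<\<eta>})}))"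
  proof
    fix \<alpha> assume "\<alpha> \<in> {\<alpha>. \<alpha> < \<gamma> \<and> e \<gamma> \<alpha> \<noteq> e \<beta> \<alpha>}"
    then have \<alpha>: "\<alpha> < \<gamma>" "e \<gamma> \<alpha> \<noteq> e \<beta> \<alpha>" "\<alpha> < \<beta>" using less.prems by auto
    let ?\<eta> = "step \<alpha> \<beta>"
    have "?\<eta> \<in> ?F"
      using step(1)[OF \<alpha>(3)] step_eqI[of \<alpha> \<gamma> \<beta>] less.prems \<alpha>(1) by (cases "?\<eta> < \<gamma>") auto
    moreover have "\<alpha> = ?\<eta> \<or> \<alpha> \<in> ?D ?\<eta> \<gamma> \<or> \<alpha> < ?\<eta> \<and> e ?\<eta> \<alpha> \<le> card (C \<beta> \<inter> {..<?\<eta>})"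
      using \<alpha> e_step[OF \<alpha>(3)] C_below_step[OF \<alpha>(3)] step(2)[OF \<alpha>(3)]
      by (auto simp: max_def order.order_iff_strict split: if_splits)
    ultimately show "\<alpha> \<in> (\<Union>\<eta>\<in>?F. insert \<eta> (?D \<eta> \<gamma> \<union> {\<alpha>. \<alpha> < \<eta> \<and> e \<eta> \<alpha> \<le> card (C \<beta> \<inter> {..<\<eta>})}))"
      by blast
  qed
  moreover have "finite (\<Union>\<eta>\<in>?F. insert \<eta> (?D \<eta> \<gamma> \<union> {\<alpha>. \<alpha> < \<eta> \<and> e \<eta> \<alpha> \<le> card (C \<beta> \<inter> {..<\<eta>})}))"
    using D finite_C_below[OF less.prems] step(3)[OF less.prems] C_less e_finite_to_one by auto
  ultimately show ?case by (rule finite_subset)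
qed

end

section \<open>Countably many restrictions to each level\<close>

lemma countable_image_factor:
  assumes "countable (l ` A)" "\<And>x y. x \<in> A \<Longrightarrow> y \<in> A \<Longrightarrow> l x = l y \<Longrightarrow> f x = f y"
  shows "countable (f ` A)"
proof -
  have "f ` A \<subseteq> (\<lambda>v. f (SOME x. x \<in> A \<and> l x = v)) ` (l ` A)"
  proof
    fix u assume "u \<in> f ` A"
    then obtain x where x: "x \<in> A" "u = f x" by auto
    define y where "y = (SOME y. y \<in> A \<and> l y = l x)"
    have y: "y \<in> A" "l y = l x" using someI[of "\<lambda>y. y \<in> A \<and> l y = l x" x] x(1) by (simp_all add: y_def)
    have "u = f y" using assms(2)[OF y(1) x(1) y(2)] x(2) by simp
    then show "u \<in> (\<lambda>v. f (SOME x. x \<in> A \<and> l x = v)) ` (l ` A)"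
      using x(1) unfolding y_def by blast
  qed
  then show ?thesis using assms(1) by (meson countable_image countable_subset)
qed

context ladder_system
begin

text \<open>The sets \<open>C \<xi> \<inter> \<gamma>\<close> met on the walk from \<open>\<beta>\<close> down to \<open>\<gamma>\<close>, a finite list of finite subsets of \<open>\<gamma>\<close>,
  carry all the information about \<open>\<beta>\<close> that is visible below \<open>\<gamma>\<close>.\<close>

primrec walk_code :: "omega1 \<Rightarrow> omega1 set list \<Rightarrow> omega1 \<Rightarrow> bool" where
  "walk_code \<gamma> [] \<beta> \<longleftrightarrow> \<beta> = \<gamma>"
| "walk_code \<gamma> (S # l) \<beta> \<longleftrightarrow> \<gamma> < \<beta> \<and> C \<beta> \<inter> {..<\<gamma>} = S \<and> walk_code \<gamma> l (step \<gamma> \<beta>)"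

lemma ex_walk_code:
  assumes "\<gamma> \<le> \<beta>"
  shows "\<exists>l\<in>lists {S. finite S \<and> S \<subseteq> {..<\<gamma>}}. walk_code \<gamma> l \<beta>"
  using assms
proof (induction \<beta> rule: less_induct)
  case (less \<beta>)
  show ?case
  proof (cases "\<gamma> = \<beta>")
    case True
    then show ?thesis by (intro bexI[of _ "[]"]) auto
  next
    case False
    then have "\<gamma> < \<beta>" using less.prems by auto
    then obtain l where "l \<in> lists {S. finite S \<and> S \<subseteq> {..<\<gamma>}}" "walk_code \<gamma> l (step \<gamma> \<beta>)"
      using less.IH[OF step(3)[OF \<open>\<gamma> < \<beta>\<close>] step(2)[OF \<open>\<gamma> < \<beta>\<close>]] by blast
    then show ?thesis
      using \<open>\<gamma> < \<beta>\<close> finite_C_below by (intro bexI[of _ "(C \<beta> \<inter> {..<\<gamma>}) # l"]) auto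
  qed
qed

text \<open>A walk towards some \<open>\<alpha> < \<gamma>\<close> follows the walk towards \<open>\<gamma>\<close> until a set of the code contains a point of
  \<open>[\<alpha>, \<gamma>)\<close>; from there on it goes to a point below \<open>\<gamma>\<close> that the code determines.\<close>

lemma walk_code_determines:
  assumes "walk_code \<gamma> l \<beta>" "walk_code \<gamma> l \<beta>'" "\<alpha> < \<gamma>"
  shows "L \<alpha> \<beta> = L \<alpha> \<beta>' \<and> e \<beta> \<alpha> = e \<beta>' \<alpha>"
  using assms(1,2)
proof (induction l arbitrary: \<beta> \<beta>')
  case (Cons S l)
  then have \<beta>: "\<gamma> < \<beta>" "\<gamma> < \<beta>'" "C \<beta> \<inter> {..<\<gamma>} = S" "C \<beta>' \<inter> {..<\<gamma>} = S" by auto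
  have lt: "\<alpha> < \<beta>" "\<alpha> < \<beta>'" using \<beta> assms(3) by auto
  have CI: "C \<beta> \<inter> {..<\<alpha>} = C \<beta>' \<inter> {..<\<alpha>}" using \<beta>(3,4) assms(3) by (metis Int_assoc Int_absorb1 Iio_Int_singleton lessThan_subset_iff less_imp_le inf.absorb_iff2)
  show ?case
  proof (cases "S \<inter> {\<alpha>..} = {}")
    case True
    have "step \<alpha> \<beta> \<notin> S" "step \<alpha> \<beta>' \<notin> S"
      using True step(2)[OF lt(1)] step(2)[OF lt(2)] by auto
    then have "step \<alpha> \<beta> = step \<gamma> \<beta>" "step \<alpha> \<beta>' = step \<gamma> \<beta>'"
      using \<beta> assms(3) step(1)[OF lt(1)] step(1)[OF lt(2)]
      by (intro step_eqI; simp add: not_less[symmetric]; blast)+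
    moreover have "L \<alpha> (step \<gamma> \<beta>) = L \<alpha> (step \<gamma> \<beta>') \<and> e (step \<gamma> \<beta>) \<alpha> = e (step \<gamma> \<beta>') \<alpha>"
      using Cons.IH[of "step \<gamma> \<beta>" "step \<gamma> \<beta>'"] Cons.prems by simp
    moreover have "step \<gamma> \<beta> \<noteq> \<alpha>" "step \<gamma> \<beta>' \<noteq> \<alpha>"
      using step(2)[OF \<beta>(1)] step(2)[OF \<beta>(2)] assms(3) by auto
    ultimately show ?thesis
      unfolding lower_trace_less[OF C_sequence lt(1)] lower_trace_less[OF C_sequence lt(2)]
        e_step[OF lt(1)] e_step[OF lt(2)] CI by simp
  next
    case False
    then obtain \<xi> where \<xi>: "\<xi> \<in> C \<beta>" "\<xi> \<in> C \<beta>'" "\<xi> < \<gamma>" "\<alpha> \<le> \<xi>"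
      using \<beta>(3,4) by auto
    have "step \<alpha> \<beta> < \<gamma>" "step \<alpha> \<beta>' < \<gamma>"
      using step_le[of \<xi>] \<xi> by (meson order_le_less_trans)+
    then have "step \<alpha> \<beta> \<in> C \<beta>'" "step \<alpha> \<beta>' \<in> C \<beta>"
      using \<beta>(3,4) step(1)[OF lt(1)] step(1)[OF lt(2)] by auto
    then have "step \<alpha> \<beta> = step \<alpha> \<beta>'"
      using step(2)[OF lt(1)] step(2)[OF lt(2)] by (intro antisym step_le)
    then show ?thesis
      unfolding lower_trace_less[OF C_sequence lt(1)] lower_trace_less[OF C_sequence lt(2)]
        e_step[OF lt(1)] e_step[OF lt(2)] CI by simp
  qed
qed simp

end

section \<open>Oscillation of two functions along a finite set\<close>

text \<open>Separating the finite set from the two functions allows comparing \<open>e\<^sub>a\<close> and \<open>e\<^sub>b\<close> along \<open>L(\<delta>, b)\<close> for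
  \<open>\<delta> \<le> a\<close>, where the set is not a lower trace between \<open>a\<close> and \<open>b\<close>.\<close>

definition osc_on :: "'a::linorder set \<Rightarrow> ('a \<Rightarrow> nat) \<Rightarrow> ('a \<Rightarrow> nat) \<Rightarrow> nat" where
  "osc_on S f g =
     card {\<zeta> \<in> S - {Min S}. f (Max (S \<inter> {..<\<zeta>})) \<le> g (Max (S \<inter> {..<\<zeta>})) \<and> f \<zeta> > g \<zeta>}"

lemma osc_eq_osc_on: "osc C \<alpha> \<beta> = osc_on (lower_trace C \<alpha> \<beta>) (walk_e C \<alpha>) (walk_e C \<beta>)"
  by (simp add: osc_def osc_on_def Let_def)

lemma Max_initial_in:
  fixes S :: "'a::linorder set"
  assumes "finite S" "\<zeta> \<in> S - {Min S}"
  shows "Max (S \<inter> {..<\<zeta>}) \<in> S \<inter> {..<\<zeta>}"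
proof (rule Max_in)
  have "Min S \<in> S \<inter> {..<\<zeta>}"
    using assms Min_in[of S] Min_le[of S \<zeta>] by (metis DiffE Int_iff emptyE lessThan_iff order_le_imp_less_or_eq singletonI)
  then show "S \<inter> {..<\<zeta>} \<noteq> {}" by blast
qed (use assms in simp)

lemma osc_on_cong:
  assumes "finite S" "\<And>x. x \<in> S \<Longrightarrow> f x = f' x" "\<And>x. x \<in> S \<Longrightarrow> g x = g' x"
  shows "osc_on S f g = osc_on S f' g'"
  unfolding osc_on_def
  by (rule arg_cong[where f=card], rule Collect_cong) (use Max_initial_in[OF assms(1)] assms in auto)

text \<open>Inside each block predecessors are unchanged; the only new place to count is the first element of the
  second block, whose predecessor is the last element of the first.\<close>

lemma osc_on_append:
  fixes S T :: "'a::linorder set"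
  assumes fin: "finite S" "finite T" and ne: "S \<noteq> {}" and lt: "\<And>x y. x \<in> S \<Longrightarrow> y \<in> T \<Longrightarrow> x < y"
  shows "osc_on (S \<union> T) f g = osc_on S f g + osc_on T f g +
     (if T \<noteq> {} \<and> f (Max S) \<le> g (Max S) \<and> f (Min T) > g (Min T) then 1 else 0)"
proof -
  define up where "up R = {\<zeta> \<in> R - {Min R}.
     f (Max (R \<inter> {..<\<zeta>})) \<le> g (Max (R \<inter> {..<\<zeta>})) \<and> f \<zeta> > g \<zeta>}" for R
  define J where "J = (if T \<noteq> {} \<and> f (Max S) \<le> g (Max S) \<and> f (Min T) > g (Min T) then {Min T} else {})"
  have osc: "osc_on R f g = card (up R)" for R by (simp add: osc_on_def up_def)
  have disj: "S \<inter> T = {}" using lt by blast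
  have min: "Min (S \<union> T) = Min S"
    
  proof (rule Min_eqI)
    show "Min S \<le> y" if "y \<in> S \<union> T" for y
      using that fin(1) lt[OF Min_in[OF fin(1) ne], of y] by auto
  qed (use fin Min_in[OF fin(1) ne] in auto)
  have pS: "(S \<union> T) \<inter> {..<\<zeta>} = S \<inter> {..<\<zeta>}" if "\<zeta> \<in> S" for \<zeta>
    using lt that by force
  have pT: "Max ((S \<union> T) \<inter> {..<\<zeta>}) = Max (T \<inter> {..<\<zeta>})" if "\<zeta> \<in> T - {Min T}" for \<zeta>
  proof -
    have "Max (T \<inter> {..<\<zeta>}) \<in> T \<inter> {..<\<zeta>}" by (rule Max_initial_in[OF fin(2) that])
    then show ?thesis
      using fin lt by (intro Max_eqI) (auto intro: less_imp_le)
  qed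
  have pM: "Max ((S \<union> T) \<inter> {..<Min T}) = Max S" if "T \<noteq> {}"
  proof -
    have "(S \<union> T) \<inter> {..<Min T} = S"
      using lt[OF _ Min_in[OF fin(2) that]] Min_le[OF fin(2)] by (auto simp: not_less[symmetric])
    then show ?thesis by simp
  qed
  have mem: "\<zeta> \<in> up (S \<union> T) \<longleftrightarrow> \<zeta> \<in> up S \<union> up T \<union> J" for \<zeta>
  proof -
    consider "\<zeta> \<in> S" | "\<zeta> \<in> T - {Min T}" | "\<zeta> = Min T" "T \<noteq> {}" | "\<zeta> \<notin> S \<union> T"
      by blast
    then show ?thesis
    proof cases
      case 1
      moreover have "\<zeta> \<notin> T" "\<zeta> \<notin> J"
        using 1 disj Min_in[OF fin(2)] by (auto simp: J_def split: if_splits)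
      ultimately show ?thesis by (simp add: up_def min pS)
    next
      case 2
      then have "\<zeta> \<notin> S" "\<zeta> \<noteq> Min S" "\<zeta> \<notin> J"
        using disj Min_in[OF fin(1) ne] by (auto simp: J_def split: if_splits)
      with 2 show ?thesis by (simp add: up_def min pT)
    next
      case 3
      have "Min T \<in> T" using 3 fin by simp
      moreover have "Min T \<notin> S" "Min T \<noteq> Min S"
        using calculation disj Min_in[OF fin(1) ne] by auto
      ultimately show ?thesis using 3 by (simp add: up_def min pM J_def)
    next
      case 4
      then show ?thesis
        using Min_in[OF fin(2)] by (auto simp: up_def J_def split: if_splits)
    qed
  qed
  have un: "up (S \<union> T) = up S \<union> up T \<union> J" using mem by blast
  have sub: "up S \<subseteq> S" "up T \<subseteq> T - {Min T}" "J \<subseteq> T \<inter> {Min T}"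
    using Min_in[OF fin(2)] by (auto simp: up_def J_def split: if_splits)
  then have "finite (up S)" "finite (up T)" "finite J"
    using fin by (meson finite_subset finite_Diff finite_Int)+
  moreover have "up S \<inter> up T = {}" "(up S \<union> up T) \<inter> J = {}"
    using sub disj by blast+
  ultimately have "card (up (S \<union> T)) = card (up S) + card (up T) + card J"
    unfolding un by (simp add: card_Un_disjoint)
  then show ?thesis by (simp add: osc J_def)
qed

lemma osc_on_append_equal:
  fixes S T :: "'a::linorder set"
  assumes "finite S" "finite T" "S \<noteq> {}" "\<And>x y. x \<in> S \<Longrightarrow> y \<in> T \<Longrightarrow> x < y"
    and "\<And>x. x \<in> T \<Longrightarrow> f x = g x"
  shows "osc_on (S \<union> T) f g = osc_on S f g"
proof -
  have "{\<zeta> \<in> T - {Min T}. f (Max (T \<inter> {..<\<zeta>})) \<le> g (Max (T \<inter> {..<\<zeta>})) \<and> f \<zeta> > g \<zeta>} = {}"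
    using assms(5) by auto
  then have "osc_on T f g = 0" by (simp only: osc_on_def card.empty)
  then show ?thesis using osc_on_append[OF assms(1-4)] assms(5)[of "Min T"] Min_in[OF assms(2)]
    by (cases "T = {}") auto
qed

lemma osc_on_append_greater:
  fixes S T :: "'a::linorder set"
  assumes "finite S" "finite T" "S \<noteq> {}" "T \<noteq> {}" "\<And>x y. x \<in> S \<Longrightarrow> y \<in> T \<Longrightarrow> x < y"
    and "f (Max S) = g (Max S)" "\<And>x. x \<in> T \<Longrightarrow> f x > g x"
  shows "osc_on (S \<union> T) f g = Suc (osc_on S f g)"
proof -
  have "{\<zeta> \<in> T - {Min T}. f (Max (T \<inter> {..<\<zeta>})) \<le> g (Max (T \<inter> {..<\<zeta>})) \<and> f \<zeta> > g \<zeta>} = {}"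
    using Max_initial_in[OF assms(2)] assms(7) by (force simp: not_le[symmetric])
  then have "osc_on T f g = 0" by (simp only: osc_on_def card.empty)
  then show ?thesis using osc_on_append[OF assms(1-3,5)] assms(2,4,6,7) by simp
qed

section \<open>Families of ordinals tending to omega-one\<close>

text \<open>A family of \<open>k\<close>-element petals \<open>{a p 0, \<dots>, a p (k - 1)}\<close> and of points \<open>b p\<close>, both indexed by the
  uncountable set \<open>X\<close> and escaping every countable level.\<close>

locale unbounded_family = ladder_system C
  for C :: "omega1 \<Rightarrow> omega1 set" +
  fixes X :: "omega1 set" and k :: nat and a :: "omega1 \<Rightarrow> nat \<Rightarrow> omega1" and b :: "omega1 \<Rightarrow> omega1"
  assumes uncountable_X: "uncountable X"
    and a_unbounded: "\<And>\<nu>. countable {p \<in> X. \<exists>i<k. a p i \<le> \<nu>}"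
    and b_unbounded: "\<And>\<nu>. countable {p \<in> X. b p \<le> \<nu>}"
begin

definition above :: "omega1 \<Rightarrow> omega1 set" where
  "above \<nu> = {p \<in> X. \<nu> \<le> p \<and> (\<forall>i<k. \<nu> < a p i) \<and> \<nu> < b p}"

lemma above_antimono: "\<nu> \<le> \<nu>' \<Longrightarrow> above \<nu>' \<subseteq> above \<nu>"
  unfolding above_def by (auto intro: order_trans order_le_less_trans)

lemma aboveD:
  assumes "p \<in> above \<nu>"
  shows "p \<in> X" "\<nu> \<le> p" "i < k \<Longrightarrow> \<nu> < a p i" "\<nu> < b p"
  using assms by (auto simp: above_def)

lemma countable_not_above: "countable (X - above \<nu>)"
proof -
  have "X - above \<nu> \<subseteq> {..\<nu>} \<union> {p \<in> X. \<exists>i<k. a p i \<le> \<nu>} \<union> {p \<in> X. b p \<le> \<nu>}"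
    by (auto simp: above_def not_less)
  then show ?thesis
    using a_unbounded b_unbounded countable_atMost_omega1 by (meson countable_Un countable_subset)
qed

lemma uncountable_above:
  assumes "A \<subseteq> X" "uncountable A"
  obtains p where "p \<in> A \<inter> above \<nu>"
proof -
  have "countable (A - above \<nu>)"
    using countable_not_above[of \<nu>] assms(1) by (meson Diff_mono countable_subset order_refl)
  then have "uncountable (A \<inter> above \<nu>)"
    using assms(2) uncountable_minus_countable_nonempty by blast
  then show thesis using that by (metis countable_empty equals0I)
qed

definition large_beyond :: "omega1 set \<Rightarrow> omega1 \<Rightarrow> bool" where
  "large_beyond A \<gamma> \<longleftrightarrow>
     (\<forall>T N \<nu>. finite T \<longrightarrow> T \<subseteq> {\<gamma>..} \<longrightarrow> (\<exists>p\<in>A \<inter> above \<nu>. \<forall>i<k. \<forall>\<zeta>\<in>T. N < e (a p i) \<zeta>))"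

text \<open>Otherwise, for a single \<open>n\<close>, uncountably many finite sets, arbitrarily far up, each meet the set of
  \<open>\<zeta>\<close> with \<open>e\<^bsub>a p i\<^esub>(\<zeta>) \<le> n\<close> for some \<open>i < k\<close>, whenever \<open>p\<close> is large. Unboundedly many of them lie below a
  suitable \<open>\<delta>\<close>, and a single \<open>p\<close> above \<open>\<delta>\<close> contradicts that the \<open>e\<^bsub>a p i\<^esub>\<close> are finite-to-one.\<close>

lemma ex_large_beyond:
  assumes A: "A \<subseteq> X" "uncountable A"
  shows "\<exists>\<gamma>. large_beyond A \<gamma>"
proof (rule ccontr)
  assume "\<not> ?thesis"
  then have "\<forall>\<gamma>. \<exists>T N \<nu>. finite T \<and> T \<subseteq> {\<gamma>..} \<and> (\<forall>p\<in>A \<inter> above \<nu>. \<exists>i<k. \<exists>\<zeta>\<in>T. e (a p i) \<zeta> \<le> N)"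
    unfolding large_beyond_def by (meson not_less)
  then obtain T N \<nu> where T: "\<And>\<gamma>. finite (T \<gamma>)" "\<And>\<gamma>. T \<gamma> \<subseteq> {\<gamma>..}"
    and bad: "\<And>\<gamma> p. p \<in> A \<inter> above (\<nu> \<gamma>) \<Longrightarrow> \<exists>i<k. \<exists>\<zeta>\<in>T \<gamma>. e (a p i) \<zeta> \<le> N \<gamma>"
    by metis
  obtain n where n: "uncountable {\<gamma> \<in> UNIV. N \<gamma> = n}"
    by (rule uncountable_fiber[OF uncountable_omega1, of N]) auto
  then have "\<exists>\<gamma>. N \<gamma> = n \<and> x < \<gamma>" for x
    by (rule uncountable_unbounded_omega1) auto
  then obtain r where r: "\<And>x. N (r x) = n" "\<And>x. x < r x" by metis
  obtain \<delta> where \<delta>: "limit1 \<delta>"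
    "\<And>x \<eta>. x < \<delta> \<Longrightarrow> \<eta> \<in> insert (r x) (insert (\<nu> (r x)) (T (r x))) \<Longrightarrow> \<eta> < \<delta>"
    using limit_closed_under[of "\<lambda>x. insert (r x) (insert (\<nu> (r x)) (T (r x)))"] T(1)
    by (metis countable_finite finite_insert)
  obtain p where p: "p \<in> A \<inter> above \<delta>" using uncountable_above[OF A] .
  define W where "W = (\<Union>i<k. {\<zeta>. \<zeta> < a p i \<and> e (a p i) \<zeta> \<le> n}) \<inter> {..<\<delta>}"
  have "finite W" "W \<subseteq> {..<\<delta>}" using e_finite_to_one by (auto simp: W_def)
  then obtain x where x: "x < \<delta>" "\<And>\<zeta>. \<zeta> \<in> W \<Longrightarrow> \<zeta> < x"
    using limit_bound_finite[OF \<delta>(1)] by blast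
  have "\<nu> (r x) \<le> \<delta>" using \<delta>(2)[OF x(1), of "\<nu> (r x)"] by simp
  then have "p \<in> A \<inter> above (\<nu> (r x))" using p above_antimono by blast
  then obtain i \<zeta> where \<zeta>: "i < k" "\<zeta> \<in> T (r x)" "e (a p i) \<zeta> \<le> n" using bad r(1) by metis
  have "\<zeta> < \<delta>" using \<delta>(2)[OF x(1)] \<zeta>(2) by blast
  moreover have "\<delta> < a p i" using p \<zeta>(1) aboveD by blast
  ultimately have "\<zeta> \<in> W" unfolding W_def using \<zeta>(1,3) by fastforce
  then have "\<zeta> < x" using x(2) by blast
  then show False using r(2)[of x] T(2)[of "r x"] \<zeta>(2) by auto
qed

section \<open>Reflecting levels\<close>

text \<open>The values of the functions \<open>e\<^bsub>a p i\<^esub>\<close> on \<open>S\<close>, packed into a finite set of pairs. Below a given level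
  there are only countably many such sets, so they can serve as parameters of a closing-off argument.\<close>

definition profile :: "omega1 \<Rightarrow> omega1 set \<Rightarrow> (omega1 \<times> nat list) set" where
  "profile p S = (\<lambda>\<zeta>. (\<zeta>, map (\<lambda>i. e (a p i) \<zeta>) [0..<k])) ` S"

definition profile_b :: "omega1 \<Rightarrow> omega1 set \<Rightarrow> (omega1 \<times> nat) set" where
  "profile_b q S = (\<lambda>\<zeta>. (\<zeta>, e (b q) \<zeta>)) ` S"

lemma fst_profile [simp]: "fst ` profile p S = S" "fst ` profile_b q S = S"
  by (force simp: profile_def profile_b_def)+

lemma finite_profile [simp]: "finite S \<Longrightarrow> finite (profile p S)" "finite S \<Longrightarrow> finite (profile_b q S)"
  by (auto simp: profile_def profile_b_def)

lemma profile_eqD: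
  assumes "profile p S = profile p' S'"
  shows "S = S'" "i < k \<Longrightarrow> \<zeta> \<in> S \<Longrightarrow> e (a p i) \<zeta> = e (a p' i) \<zeta>"
proof -
  show S: "S = S'" using assms fst_profile(1) by metis
  assume "i < k" "\<zeta> \<in> S"
  then have "(\<zeta>, map (\<lambda>i. e (a p i) \<zeta>) [0..<k]) \<in> profile p' S'"
    unfolding assms[symmetric] by (auto simp: profile_def)
  then show "e (a p i) \<zeta> = e (a p' i) \<zeta>" using \<open>i < k\<close> by (auto simp: profile_def)
qed

lemma profile_b_eqD:
  assumes "profile_b q S = profile_b q' S'"
  shows "S = S'" "\<zeta> \<in> S \<Longrightarrow> e (b q) \<zeta> = e (b q') \<zeta>"
proof -
  show S: "S = S'" using assms fst_profile(2) by metis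
  assume "\<zeta> \<in> S"
  then have "(\<zeta>, e (b q) \<zeta>) \<in> profile_b q' S'"
    unfolding assms[symmetric] by (auto simp: profile_b_def)
  then show "e (b q) \<zeta> = e (b q') \<zeta>" by (auto simp: profile_b_def)
qed

definition with_profile :: "(omega1 \<times> nat list) set \<Rightarrow> omega1 set" where
  "with_profile R = {p \<in> X. profile p (fst ` R) = R}"

text \<open>The levels \<open>\<delta>\<close> at which the situation described by the parameters \<open>m\<close>, \<open>R\<close>, \<open>R'\<close> occurs. As \<open>m\<close> is required to
  lie in \<open>C \<delta>\<close>, every lower trace \<open>L \<alpha> \<delta>\<close> with \<open>m < \<alpha> < \<delta>\<close> is a nonempty subset of \<open>[m, \<alpha>)\<close>.\<close>

definition good_levels :: "omega1 \<Rightarrow> (omega1 \<times> nat list) set \<Rightarrow> (omega1 \<times> nat) set \<Rightarrow> omega1 set" where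
  "good_levels m R R' = {\<delta>. m \<in> C \<delta> \<and> (\<exists>p\<in>above \<delta>. \<exists>q\<in>above \<delta>.
     profile p (L \<delta> (b q)) = R \<and> profile_b q (L \<delta> (b q)) = R' \<and>
     (\<forall>i<k. \<forall>\<zeta>. m \<le> \<zeta> \<longrightarrow> \<zeta> < \<delta> \<longrightarrow> e (a p i) \<zeta> = e (b q) \<zeta>))}"

text \<open>The three instances of elementarity that the oscillation argument uses: a situation that occurs at \<open>\<delta>\<close>
  occurs at uncountably many levels; the threshold from \<open>ex_large_beyond\<close> for parameters below \<open>\<delta>\<close> can
  be chosen below \<open>\<delta>\<close>; and a profile realised by a petal with index at least \<open>\<delta>\<close> is realised by petals below \<open>\<delta>\<close>
  that lie above any given \<open>\<mu> < \<delta>\<close>.\<close>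

definition reflecting :: "omega1 \<Rightarrow> bool" where
  "reflecting \<delta> \<longleftrightarrow> limit1 \<delta> \<and>
    (\<forall>m R R'. m < \<delta> \<longrightarrow> finite R \<longrightarrow> R \<subseteq> {..<\<delta>} \<times> UNIV \<longrightarrow> finite R' \<longrightarrow> R' \<subseteq> {..<\<delta>} \<times> UNIV \<longrightarrow>
       \<delta> \<in> good_levels m R R' \<longrightarrow> uncountable (good_levels m R R')) \<and>
    (\<forall>R. finite R \<longrightarrow> R \<subseteq> {..<\<delta>} \<times> UNIV \<longrightarrow> (\<exists>p\<ge>\<delta>. p \<in> with_profile R) \<longrightarrow>
       (\<exists>\<gamma><\<delta>. large_beyond (with_profile R) \<gamma>) \<and>
       (\<forall>\<mu><\<delta>. \<exists>p\<in>with_profile R \<inter> above \<mu>. p < \<delta> \<and> (\<forall>i<k. a p i < \<delta>)))"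

lemma ex_reflecting: "\<exists>\<delta>. reflecting \<delta>"
proof -
  define F :: "omega1 \<Rightarrow> (omega1 \<times> nat list) set set" where
    "F \<nu> = {R. finite R \<and> R \<subseteq> {..<\<nu>} \<times> UNIV}" for \<nu>
  define F' :: "omega1 \<Rightarrow> (omega1 \<times> nat) set set" where
    "F' \<nu> = {R. finite R \<and> R \<subseteq> {..<\<nu>} \<times> UNIV}" for \<nu>
  have cF: "countable (F \<nu>)" "countable (F' \<nu>)" for \<nu>
    unfolding F_def F'_def by (intro countable_Collect_finite_subset countable_SIGMA countable_lessThan_omega1; simp)+
  (* Countable sets with parameters below a level are put into H, so that an element outside
     the level witnesses uncountability. *)
  define small where "small A = (if countable A then A else {})" for A :: "omega1 set"
  have csmall: "countable (small A)" for A by (simp add: small_def)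
  define g where "g R = (SOME \<gamma>. large_beyond (with_profile R) \<gamma>)" for R
  define w where "w R \<mu> = (SOME p. p \<in> with_profile R \<inter> above \<mu>)" for R \<mu>
  define H where "H \<nu> = (\<Union>m\<in>{..<\<nu>}. \<Union>R\<in>F \<nu>. \<Union>R'\<in>F' \<nu>. small (good_levels m R R')) \<union>
     (\<Union>R\<in>F \<nu>. small (with_profile R)) \<union> g ` F \<nu> \<union>
     (\<Union>R\<in>F \<nu>. \<Union>\<mu>\<in>{..<\<nu>}. insert (w R \<mu>) (a (w R \<mu>) ` {..<k}))" for \<nu>
  have "countable (H \<nu>)" for \<nu>
    unfolding H_def by (intro countable_Un countable_UN cF csmall countable_lessThan_omega1 countable_image
        countable_insert countable_finite finite_imageI finite_lessThan)
  then obtain \<delta> where \<delta>: "limit1 \<delta>" "\<And>\<nu> \<eta>. \<nu> < \<delta> \<Longrightarrow> \<eta> \<in> H \<nu> \<Longrightarrow> \<eta> < \<delta>"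
    using limit_closed_under by metis
  have bound: "\<exists>\<nu><\<delta>. m < \<nu> \<and> R \<in> F \<nu> \<and> R' \<in> F' \<nu>"
    if m: "m < \<delta>" and R: "finite R" "R \<subseteq> {..<\<delta>} \<times> UNIV" and R': "finite R'" "R' \<subseteq> {..<\<delta>} \<times> UNIV" for m R R'
  proof -
    have "finite (insert m (fst ` R \<union> fst ` R'))" "insert m (fst ` R \<union> fst ` R') \<subseteq> {..<\<delta>}"
      using that by (auto dest: subsetD)
    then obtain \<nu> where \<nu>: "\<nu> < \<delta>" "\<And>x. x \<in> insert m (fst ` R \<union> fst ` R') \<Longrightarrow> x < \<nu>"
      using limit_bound_finite[OF \<delta>(1)] by blast
    have "m < \<nu>" using \<nu>(2) by simp
    moreover have "fst ` R \<subseteq> {..<\<nu>}" "fst ` R' \<subseteq> {..<\<nu>}" using \<nu>(2) by auto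
    then have "R \<subseteq> {..<\<nu>} \<times> UNIV" "R' \<subseteq> {..<\<nu>} \<times> UNIV" by fastforce+
    ultimately show ?thesis using \<nu>(1) R(1) R'(1) by (auto simp: F_def F'_def)
  qed
  have "reflecting \<delta>"
    unfolding reflecting_def
  proof (intro conjI allI impI)
    show "limit1 \<delta>" by fact
  next
    fix m R R' assume *: "m < \<delta>" "finite R" "R \<subseteq> {..<\<delta>} \<times> UNIV" "finite R'" "R' \<subseteq> {..<\<delta>} \<times> UNIV"
      and \<delta>in: "\<delta> \<in> good_levels m R R'"
    obtain \<nu> where \<nu>: "\<nu> < \<delta>" "m < \<nu>" "R \<in> F \<nu>" "R' \<in> F' \<nu>" using bound[OF *] by blast
    show "uncountable (good_levels m R R')"
    proof
      assume "countable (good_levels m R R')"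
      then have "\<delta> \<in> small (good_levels m R R')" using \<delta>in by (simp add: small_def)
      then have "\<delta> \<in> H \<nu>" using \<nu> unfolding H_def by blast
      then show False using \<delta>(2) \<nu>(1) by blast
    qed
  next
    fix R assume R: "finite R" "R \<subseteq> {..<\<delta>} \<times> UNIV" "\<exists>p\<ge>\<delta>. p \<in> with_profile R"
    have 0: "0 < \<delta>" using \<delta>(1) zero_le_omega1[of \<delta>] by (auto simp: limit1_def order.order_iff_strict)
    obtain \<nu> where \<nu>: "\<nu> < \<delta>" "R \<in> F \<nu>" using bound[OF 0 R(1,2), of "{}"] by auto
    have unc: "uncountable (with_profile R)"
    proof
      assume "countable (with_profile R)"
      then obtain p where "\<delta> \<le> p" "p \<in> small (with_profile R)" using R(3) by (auto simp: small_def)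
      then have "p \<in> H \<nu>" using \<nu> unfolding H_def by blast
      then show False using \<delta>(2)[OF \<nu>(1), of p] \<open>\<delta> \<le> p\<close> by auto
    qed
    have subX: "with_profile R \<subseteq> X" by (auto simp: with_profile_def)
    have "large_beyond (with_profile R) (g R)"
      unfolding g_def using ex_large_beyond[OF subX unc] by (rule someI_ex)
    moreover have "g R < \<delta>" using \<delta>(2)[OF \<nu>(1)] \<nu>(2) by (auto simp: H_def)
    ultimately show "\<exists>\<gamma><\<delta>. large_beyond (with_profile R) \<gamma>" by blast
    fix \<mu> assume "\<mu> < \<delta>"
    then obtain \<nu> where \<nu>: "\<nu> < \<delta>" "\<mu> < \<nu>" "R \<in> F \<nu>" using bound[OF _ R(1,2), of \<mu> "{}"] by auto
    have "\<exists>p. p \<in> with_profile R \<inter> above \<mu>" using uncountable_above[OF subX unc] by blast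
    then have "w R \<mu> \<in> with_profile R \<inter> above \<mu>" unfolding w_def by (rule someI_ex)
    moreover have "\<eta> \<in> H \<nu>" if "\<eta> \<in> insert (w R \<mu>) (a (w R \<mu>) ` {..<k})" for \<eta>
      unfolding H_def by (rule UnI2, rule UN_I[OF \<nu>(3)], rule UN_I[of \<mu>]) (use \<nu>(2) that in simp_all)
    then have "\<eta> < \<delta>" if "\<eta> \<in> insert (w R \<mu>) (a (w R \<mu>) ` {..<k})" for \<eta>
      using \<delta>(2)[OF \<nu>(1)] that by metis
    ultimately show "\<exists>p\<in>with_profile R \<inter> above \<mu>. p < \<delta> \<and> (\<forall>i<k. a p i < \<delta>)"
      by (intro bexI[of _ "w R \<mu>"]) auto
  qed
  then show ?thesis by blast
qed

lemma coherent_bound: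
  assumes "limit1 \<delta>" "finite B" "\<And>\<beta>. \<beta> \<in> B \<Longrightarrow> \<delta> < \<beta>"
  obtains \<nu> where "\<nu> < \<delta>" "\<And>\<beta> \<zeta>. \<beta> \<in> B \<Longrightarrow> \<nu> \<le> \<zeta> \<Longrightarrow> \<zeta> < \<delta> \<Longrightarrow> e \<beta> \<zeta> = e \<delta> \<zeta>"
proof -
  have "finite (\<Union>\<beta>\<in>B. {\<zeta>. \<zeta> < \<delta> \<and> e \<delta> \<zeta> \<noteq> e \<beta> \<zeta>})" (is "finite ?W")
    using e_coherent assms(2,3) by blast
  moreover have "?W \<subseteq> {..<\<delta>}" by auto
  ultimately obtain \<nu> where \<nu>: "\<nu> < \<delta>" "\<And>x. x \<in> ?W \<Longrightarrow> x < \<nu>"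
    using limit_bound_finite[OF assms(1)] by blast
  show thesis
  proof (rule that[OF \<nu>(1)])
    fix \<beta> \<zeta> assume "\<beta> \<in> B" "\<nu> \<le> \<zeta>" "\<zeta> < \<delta>"
    then show "e \<beta> \<zeta> = e \<delta> \<zeta>" using \<nu>(2)[of \<zeta>] by fastforce
  qed
qed

text \<open>Above some \<open>m \<in> C \<delta>\<close> the functions for \<open>p\<close> and \<open>q\<close> agree with \<open>e\<^sub>\<delta>\<close>, so \<open>\<delta>\<close> is a good level for the
  parameters read off from \<open>p\<close> and \<open>q\<close>. Reflection yields a good level \<open>\<delta>' > \<delta>\<close> with witnesses \<open>p'\<close>, \<open>q'\<close>; then
  \<open>L(\<delta>, b q')\<close> splits into \<open>L(\<delta>', b q') = L(\<delta>, b q)\<close> and the new block \<open>T = L(\<delta>, \<delta>') \<subseteq> [m, \<delta>)\<close>.\<close>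

lemma extend_equal:
  assumes \<delta>: "reflecting \<delta>" and p: "p \<in> above \<delta>" and q: "q \<in> above \<delta>" and \<gamma>: "\<gamma> < \<delta>"
  obtains p' q' T where "p' \<in> above \<delta>" "q' \<in> above \<delta>"
    "finite T" "T \<noteq> {}" "T \<subseteq> {\<gamma>..<\<delta>}" "L \<delta> (b q') = L \<delta> (b q) \<union> T"
    "\<And>x y. x \<in> L \<delta> (b q) \<Longrightarrow> y \<in> T \<Longrightarrow> x < y"
    "\<And>i x. i < k \<Longrightarrow> x \<in> L \<delta> (b q) \<Longrightarrow> e (a p' i) x = e (a p i) x"
    "\<And>x. x \<in> L \<delta> (b q) \<Longrightarrow> e (b q') x = e (b q) x"
    "\<And>i x. i < k \<Longrightarrow> x \<in> T \<Longrightarrow> e (a p' i) x = e (b q') x"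
proof -
  define S where "S = L \<delta> (b q)"
  have lim: "limit1 \<delta>" using \<delta> by (simp add: reflecting_def)
  have S: "finite S" "S \<subseteq> {..<\<delta>}" by (simp_all add: S_def finite_L L_subset)
  obtain \<nu>1 where \<nu>1: "\<nu>1 < \<delta>" "\<And>x. x \<in> S \<Longrightarrow> x < \<nu>1" using limit_bound_finite[OF lim S] by blast
  obtain \<nu>2 where \<nu>2: "\<nu>2 < \<delta>" "\<And>\<beta> \<zeta>. \<beta> \<in> insert (b q) (a p ` {..<k}) \<Longrightarrow> \<nu>2 \<le> \<zeta> \<Longrightarrow> \<zeta> < \<delta> \<Longrightarrow> e \<beta> \<zeta> = e \<delta> \<zeta>"
    by (rule coherent_bound[OF lim, of "insert (b q) (a p ` {..<k})"])
      (use aboveD[OF p] aboveD[OF q] in auto)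
  obtain m where m: "m \<in> C \<delta>" "max \<gamma> (max \<nu>1 \<nu>2) \<le> m"
    using C_cofinal[OF lim, of "max \<gamma> (max \<nu>1 \<nu>2)"] \<gamma> \<nu>1(1) \<nu>2(1) by auto
  define G where "G = good_levels m (profile p S) (profile_b q S)"
  have "e (a p i) \<zeta> = e (b q) \<zeta>" if "i < k" "m \<le> \<zeta>" "\<zeta> < \<delta>" for i \<zeta>
    using \<nu>2(2)[of "a p i" \<zeta>] \<nu>2(2)[of "b q" \<zeta>] that m(2) by auto
  then have "\<delta> \<in> G"
    unfolding G_def good_levels_def using m(1) p q S_def by blast
  moreover have "profile p S \<subseteq> {..<\<delta>} \<times> UNIV" "profile_b q S \<subseteq> {..<\<delta>} \<times> UNIV"
    using S(2) by (auto simp: profile_def profile_b_def)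
  ultimately have "uncountable G"
    using \<delta> C_less[OF m(1)] S(1) unfolding reflecting_def G_def by simp
  then obtain \<delta>' where \<delta>': "\<delta>' \<in> G" "\<delta> < \<delta>'" by (rule uncountable_unbounded_omega1)
  then obtain p' q' where pq: "m \<in> C \<delta>'" "p' \<in> above \<delta>'" "q' \<in> above \<delta>'"
    "profile p' (L \<delta>' (b q')) = profile p S" "profile_b q' (L \<delta>' (b q')) = profile_b q S"
    "\<And>i \<zeta>. i < k \<Longrightarrow> m \<le> \<zeta> \<Longrightarrow> \<zeta> < \<delta>' \<Longrightarrow> e (a p' i) \<zeta> = e (b q') \<zeta>"
    unfolding G_def good_levels_def by blast
  have LS: "L \<delta>' (b q') = S" using profile_eqD(1)[OF pq(4)] .
  define T where "T = L \<delta> \<delta>'"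
  have T: "T \<noteq> {}" "\<And>y. y \<in> T \<Longrightarrow> m \<le> y" "\<And>y. y \<in> T \<Longrightarrow> y < \<delta>"
    using L_ge[OF \<delta>'(2) pq(1) C_less[OF m(1)]] L_subset unfolding T_def by auto
  have lt: "x < y" if "x \<in> S" "y \<in> T" for x y
    using \<nu>1(2)[OF that(1)] m(2) T(2)[OF that(2)] by auto
  have "L \<delta> (b q') = L \<delta> \<delta>' \<union> L \<delta>' (b q')"
  proof (rule L_concat)
    show "\<delta> \<le> \<delta>'" "\<delta>' \<le> b q'" using \<delta>'(2) aboveD(4)[OF pq(3)] by auto
  qed (use S(2) lt LS T_def in auto)
  then have "L \<delta> (b q') = S \<union> T" by (simp add: LS T_def Un_commute)
  moreover have "p' \<in> above \<delta>" "q' \<in> above \<delta>"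
    using pq(2,3) above_antimono[OF less_imp_le[OF \<delta>'(2)]] by auto
  moreover have "e (a p' i) x = e (a p i) x" if "i < k" "x \<in> S" for i x
    using profile_eqD(2)[OF pq(4) that(1)] that(2) LS by simp
  moreover have "e (b q') x = e (b q) x" if "x \<in> S" for x
    using profile_b_eqD(2)[OF pq(5)] that LS by simp
  moreover have "e (a p' i) x = e (b q') x" if "i < k" "x \<in> T" for i x
    using pq(6)[OF that(1)] T(2,3)[OF that(2)] \<delta>'(2) by auto
  moreover have "T \<subseteq> {\<gamma>..<\<delta>}" using T m(2) by fastforce
  moreover have "finite T" by (simp add: T_def finite_L)
  ultimately show thesis using that[of p' q' T] T(1) lt unfolding S_def by blast
qed

text \<open>The block from \<open>extend_equal\<close> is kept, and only the petal is exchanged for one with the same values on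
  \<open>L(\<delta>, b q)\<close> and with larger values on the block. This is possible if the block lies beyond the threshold of
  \<open>large_beyond\<close>, which is why \<open>extend_equal\<close> allows prescribing a lower bound \<open>\<gamma>\<close>.\<close>

lemma extend_greater:
  assumes \<delta>: "reflecting \<delta>" and p: "p \<in> above \<delta>" and q: "q \<in> above \<delta>"
  obtains p' q' T where "p' \<in> above \<delta>" "q' \<in> above \<delta>"
    "finite T" "T \<noteq> {}" "L \<delta> (b q') = L \<delta> (b q) \<union> T"
    "\<And>x y. x \<in> L \<delta> (b q) \<Longrightarrow> y \<in> T \<Longrightarrow> x < y"
    "\<And>i x. i < k \<Longrightarrow> x \<in> L \<delta> (b q) \<Longrightarrow> e (a p' i) x = e (a p i) x"
    "\<And>x. x \<in> L \<delta> (b q) \<Longrightarrow> e (b q') x = e (b q) x"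
    "\<And>i x. i < k \<Longrightarrow> x \<in> T \<Longrightarrow> e (a p' i) x > e (b q') x"
proof -
  define S where "S = L \<delta> (b q)"
  define A where "A = with_profile (profile p S)"
  have S: "finite S" "S \<subseteq> {..<\<delta>}" by (simp_all add: S_def finite_L L_subset)
  have "profile p S \<subseteq> {..<\<delta>} \<times> UNIV" using S(2) by (auto simp: profile_def)
  moreover have "p \<in> A" using aboveD(1)[OF p] by (simp add: A_def with_profile_def)
  ultimately obtain \<gamma> where \<gamma>: "\<gamma> < \<delta>" "large_beyond A \<gamma>"
    using \<delta> aboveD(2)[OF p] S(1) unfolding reflecting_def A_def by (meson finite_profile(1))
  obtain p1 q' T where T: "q' \<in> above \<delta>" "finite T" "T \<noteq> {}" "T \<subseteq> {\<gamma>..<\<delta>}" "L \<delta> (b q') = S \<union> T"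
    "\<And>x y. x \<in> S \<Longrightarrow> y \<in> T \<Longrightarrow> x < y" "\<And>x. x \<in> S \<Longrightarrow> e (b q') x = e (b q) x"
    unfolding S_def by (rule extend_equal[OF \<delta> p q \<gamma>(1)]) blast
  define N where "N = Max (e (b q') ` T)"
  have N: "e (b q') x \<le> N" if "x \<in> T" for x using that T(2) by (simp add: N_def)
  have "T \<subseteq> {\<gamma>..}" using T(4) by auto
  then obtain p' where p': "p' \<in> A" "p' \<in> above \<delta>" "\<And>i \<zeta>. i < k \<Longrightarrow> \<zeta> \<in> T \<Longrightarrow> N < e (a p' i) \<zeta>"
    using \<gamma>(2)[unfolded large_beyond_def, rule_format, OF T(2), of \<delta> N] by auto
  have "profile p' S = profile p S" using p'(1) by (simp add: A_def with_profile_def)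
  then have "e (a p' i) x = e (a p i) x" if "i < k" "x \<in> S" for i x
    using profile_eqD(2) that by blast
  moreover have "e (a p' i) x > e (b q') x" if "i < k" "x \<in> T" for i x
    using p'(3)[OF that] N[OF that(2)] by simp
  ultimately show thesis using that[of p' q' T] p'(2) T unfolding S_def by blast
qed

end

section \<open>The oscillation theorem\<close>

lemma Max_append_in:
  fixes S T :: "'a::linorder set"
  assumes "finite S" "finite T" "T \<noteq> {}" "\<And>x y. x \<in> S \<Longrightarrow> y \<in> T \<Longrightarrow> x < y"
  shows "Max (S \<union> T) \<in> T"
proof -
  have "Max (S \<union> T) = Max T"
  proof (rule Max_eqI)
    show "y \<le> Max T" if "y \<in> S \<union> T" for y
      using that assms(2) assms(4)[OF _ Max_in[OF assms(2,3)], of y] by auto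
  qed (use assms Max_in[OF assms(2,3)] in auto)
  then show ?thesis using Max_in[OF assms(2,3)] by simp
qed

context unbounded_family
begin

text \<open>One block of equality followed by one block of strict inequality raises every oscillation by one. The traces
  form an increasing chain and later petals keep the values on earlier traces, so a single petal \<open>p\<close> serves
  all \<open>m\<close>. The condition at the maximum keeps the junction with a further block from counting.\<close>

lemma oscillation_chain:
  assumes \<delta>: "reflecting \<delta>"
  shows "\<exists>p\<in>above \<delta>. \<exists>q. \<forall>m\<le>n. q m \<in> above \<delta> \<and> L \<delta> (b (q m)) \<noteq> {} \<and>
     L \<delta> (b (q m)) \<subseteq> L \<delta> (b (q n)) \<and>
     (\<forall>i<k. e (a p i) (Max (L \<delta> (b (q m)))) > e (b (q m)) (Max (L \<delta> (b (q m)))) \<and>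
        osc_on (L \<delta> (b (q m))) (e (a p i)) (e (b (q m))) =
        osc_on (L \<delta> (b (q 0))) (e (a p i)) (e (b (q 0))) + m)"
proof (induction n)
  case 0
  obtain p q where pq: "p \<in> above \<delta>" "q \<in> above \<delta>"
    using uncountable_above[OF order_refl uncountable_X] by blast
  obtain p' q' T where *: "p' \<in> above \<delta>" "q' \<in> above \<delta>"
    "finite T" "T \<noteq> {}" "L \<delta> (b q') = L \<delta> (b q) \<union> T"
    "\<And>x y. x \<in> L \<delta> (b q) \<Longrightarrow> y \<in> T \<Longrightarrow> x < y"
    "\<And>i x. i < k \<Longrightarrow> x \<in> T \<Longrightarrow> e (a p' i) x > e (b q') x"
    by (rule extend_greater[OF \<delta> pq]) (rule that; assumption)
  have "Max (L \<delta> (b q')) \<in> T"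
    unfolding *(5) by (rule Max_append_in[OF finite_L *(3,4,6)])
  then show ?case
    using *(1,2,4,5,7) by (intro bexI[of _ p'] exI[of _ "\<lambda>_. q'"]) auto
next
  case (Suc n)
  then obtain p q where p: "p \<in> above \<delta>"
    and q: "\<And>m. m \<le> n \<Longrightarrow> q m \<in> above \<delta> \<and> L \<delta> (b (q m)) \<noteq> {} \<and> L \<delta> (b (q m)) \<subseteq> L \<delta> (b (q n))"
    and osc: "\<And>m i. m \<le> n \<Longrightarrow> i < k \<Longrightarrow>
        e (a p i) (Max (L \<delta> (b (q m)))) > e (b (q m)) (Max (L \<delta> (b (q m)))) \<and>
        osc_on (L \<delta> (b (q m))) (e (a p i)) (e (b (q m))) =
        osc_on (L \<delta> (b (q 0))) (e (a p i)) (e (b (q 0))) + m"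
    by blast
  define S where "S = L \<delta> (b (q n))"
  have S: "finite S" "S \<noteq> {}" using q[of n] by (auto simp: S_def finite_L)
  have "q n \<in> above \<delta>" using q by blast
  have "0 < \<delta>" using \<delta> zero_le_omega1[of \<delta>] by (auto simp: reflecting_def limit1_def order.order_iff_strict)
  obtain p1 q1 T1 where 1: "p1 \<in> above \<delta>" "q1 \<in> above \<delta>"
    "finite T1" "T1 \<noteq> {}" "L \<delta> (b q1) = S \<union> T1"
    "\<And>x y. x \<in> S \<Longrightarrow> y \<in> T1 \<Longrightarrow> x < y"
    "\<And>i x. i < k \<Longrightarrow> x \<in> S \<Longrightarrow> e (a p1 i) x = e (a p i) x"
    "\<And>x. x \<in> S \<Longrightarrow> e (b q1) x = e (b (q n)) x"
    "\<And>i x. i < k \<Longrightarrow> x \<in> T1 \<Longrightarrow> e (a p1 i) x = e (b q1) x"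
    by (rule extend_equal[OF \<delta> p \<open>q n \<in> above \<delta>\<close> \<open>0 < \<delta>\<close>, folded S_def]) (rule that; assumption)
  obtain p2 q2 T2 where 2: "p2 \<in> above \<delta>" "q2 \<in> above \<delta>"
    "finite T2" "T2 \<noteq> {}" "L \<delta> (b q2) = S \<union> T1 \<union> T2"
    "\<And>x y. x \<in> S \<union> T1 \<Longrightarrow> y \<in> T2 \<Longrightarrow> x < y"
    "\<And>i x. i < k \<Longrightarrow> x \<in> S \<union> T1 \<Longrightarrow> e (a p2 i) x = e (a p1 i) x"
    "\<And>x. x \<in> S \<union> T1 \<Longrightarrow> e (b q2) x = e (b q1) x"
    "\<And>i x. i < k \<Longrightarrow> x \<in> T2 \<Longrightarrow> e (a p2 i) x > e (b q2) x"
    by (rule extend_greater[OF \<delta> 1(1,2), unfolded 1(5)]) (rule that; assumption)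
  have a2: "e (a p2 i) x = e (a p i) x" if "i < k" "x \<in> S" for i x
    using 1(7) 2(7) that by simp
  have a2': "e (a p2 i) x = e (a p i) x" if "m \<le> n" "i < k" "x \<in> L \<delta> (b (q m))" for m i x
    using a2[OF that(2)] q[OF that(1)] that(3) S_def by blast
  have old: "osc_on (L \<delta> (b (q m))) (e (a p2 i)) (e (b (q m)))
      = osc_on (L \<delta> (b (q m))) (e (a p i)) (e (b (q m)))" if "m \<le> n" "i < k" for m i
    using a2'[OF that] by (intro osc_on_cong finite_L) auto
  define q' where "q' = q(Suc n := q2)"
  have new: "osc_on (L \<delta> (b q2)) (e (a p2 i)) (e (b q2)) = Suc (osc_on S (e (a p i)) (e (b (q n))))"
    if i: "i < k" for i
  proof -
    have M: "Max (S \<union> T1) \<in> T1" by (rule Max_append_in[OF S(1) 1(3,4,6)])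
    then have "e (a p2 i) (Max (S \<union> T1)) = e (b q2) (Max (S \<union> T1))"
      using 2(7)[OF i] 2(8) 1(9)[OF i] by simp
    then have "osc_on (S \<union> T1 \<union> T2) (e (a p2 i)) (e (b q2)) = Suc (osc_on (S \<union> T1) (e (a p2 i)) (e (b q2)))"
      using S 1(3) 2(3,4,6) 2(9)[OF i] by (intro osc_on_append_greater) auto
    also have "osc_on (S \<union> T1) (e (a p2 i)) (e (b q2)) = osc_on S (e (a p2 i)) (e (b q2))"
      using 2(7)[OF i] 2(8) 1(9)[OF i] by (intro osc_on_append_equal S 1(3,6)) auto
    also have "\<dots> = osc_on S (e (a p i)) (e (b (q n)))"
      using a2[OF i] 1(8) 2(8) by (intro osc_on_cong S) auto
    finally show ?thesis unfolding 2(5) .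
  qed
  have M2: "Max (L \<delta> (b q2)) \<in> T2"
    unfolding 2(5) using S 1(3) by (intro Max_append_in 2) auto
  show ?case
  proof (intro bexI[of _ p2] exI[of _ q'] allI impI conjI 2(1))
    fix m assume m: "m \<le> Suc n"
    show "q' m \<in> above \<delta>" using q[of m] 2(2) m by (auto simp: q'_def)
    show "L \<delta> (b (q' m)) \<noteq> {}" using q[of m] 2(4,5) m by (auto simp: q'_def)
    show "L \<delta> (b (q' m)) \<subseteq> L \<delta> (b (q' (Suc n)))"
      using q[of m] 2(5) m unfolding q'_def S_def by (cases "m = Suc n") auto
    fix i assume i: "i < k"
    show "e (b (q' m)) (Max (L \<delta> (b (q' m)))) < e (a p2 i) (Max (L \<delta> (b (q' m))))"
    proof (cases "m = Suc n")
      case True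
      then show ?thesis using 2(9)[OF i M2] by (simp add: q'_def)
    next
      case False
      then have m: "m \<le> n" using m by simp
      have "Max (L \<delta> (b (q m))) \<in> L \<delta> (b (q m))" using q[OF m] finite_L by simp
      then show ?thesis using osc[OF m i] a2'[OF m i] False by (simp add: q'_def)
    qed
    show "osc_on (L \<delta> (b (q' m))) (e (a p2 i)) (e (b (q' m))) =
        osc_on (L \<delta> (b (q' 0))) (e (a p2 i)) (e (b (q' 0))) + m"
    proof (cases "m = Suc n")
      case True
      have "osc_on (L \<delta> (b q2)) (e (a p2 i)) (e (b q2)) =
        Suc (osc_on (L \<delta> (b (q 0))) (e (a p i)) (e (b (q 0))) + n)"
        using new[OF i] osc[OF order_refl i] by (simp add: S_def)
      then show ?thesis using old[of 0, OF _ i] True by (simp add: q'_def)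
    next
      case False
      then have m: "m \<le> n" using m by simp
      show ?thesis using osc[OF m i] old[OF m i] old[of 0, OF _ i] False by (simp add: q'_def)
    qed
  qed
qed

text \<open>In the chain above the petal sits above \<open>\<delta>\<close>. Reflecting it to a petal \<open>p'\<close> just below \<open>\<delta>\<close> with the same values on
  all the traces turns \<open>L(\<delta>, b)\<close> into an initial segment of \<open>L(\<alpha>, b)\<close> for each \<open>\<alpha>\<close> of the petal. The remaining segment
  \<open>L(\<alpha>, \<delta>)\<close> is the same for all \<open>b\<close>, and there all \<open>e\<^sub>b\<close> agree with \<open>e\<^sub>\<delta>\<close>, so it contributes a constant.\<close>

theorem oscillation_attains_shifts:
  "\<exists>p\<in>X. \<exists>q. \<forall>m\<le>n. q m \<in> X \<and> p < q m \<and>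
     (\<forall>i<k. a p i < b (q m) \<and> osc C (a p i) (b (q m)) = osc C (a p i) (b (q 0)) + m)"
proof -
  obtain \<delta> where \<delta>: "reflecting \<delta>" using ex_reflecting by blast
  then have lim: "limit1 \<delta>" by (simp add: reflecting_def)
  obtain p q where p: "p \<in> above \<delta>"
    and q: "\<And>m. m \<le> n \<Longrightarrow> q m \<in> above \<delta>" "\<And>m. m \<le> n \<Longrightarrow> L \<delta> (b (q m)) \<noteq> {}"
      "\<And>m. m \<le> n \<Longrightarrow> L \<delta> (b (q m)) \<subseteq> L \<delta> (b (q n))"
    and osc: "\<And>m i. m \<le> n \<Longrightarrow> i < k \<Longrightarrow> e (a p i) (Max (L \<delta> (b (q m)))) > e (b (q m)) (Max (L \<delta> (b (q m))))"
      "\<And>m i. m \<le> n \<Longrightarrow> i < k \<Longrightarrow> osc_on (L \<delta> (b (q m))) (e (a p i)) (e (b (q m))) =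
        osc_on (L \<delta> (b (q 0))) (e (a p i)) (e (b (q 0))) + m"
    using oscillation_chain[OF \<delta>, of n] by blast
  define S where "S m = L \<delta> (b (q m))" for m
  have S: "finite (S m)" "S m \<subseteq> {..<\<delta>}" for m by (simp_all add: S_def finite_L L_subset)
  obtain \<nu>1 where \<nu>1: "\<nu>1 < \<delta>" "\<And>x. x \<in> S n \<Longrightarrow> x < \<nu>1" using limit_bound_finite[OF lim S] by blast
  obtain \<nu>2 where \<nu>2: "\<nu>2 < \<delta>" "\<And>\<beta> \<zeta>. \<beta> \<in> (\<lambda>m. b (q m)) ` {..n} \<Longrightarrow> \<nu>2 \<le> \<zeta> \<Longrightarrow> \<zeta> < \<delta> \<Longrightarrow> e \<beta> \<zeta> = e \<delta> \<zeta>"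
    by (rule coherent_bound[OF lim, of "(\<lambda>m. b (q m)) ` {..n}"]) (use aboveD(4) q(1) in auto)
  obtain m0 where m0: "m0 \<in> C \<delta>" "max \<nu>1 \<nu>2 \<le> m0"
    using C_cofinal[OF lim, of "max \<nu>1 \<nu>2"] \<nu>1(1) \<nu>2(1) by auto
  have "profile p (S n) \<subseteq> {..<\<delta>} \<times> UNIV" using S(2) by (auto simp: profile_def)
  moreover have "p \<in> with_profile (profile p (S n))"
    using aboveD(1)[OF p] by (simp add: with_profile_def)
  ultimately obtain p' where p': "p' \<in> with_profile (profile p (S n)) \<inter> above m0"
      "p' < \<delta>" "\<And>i. i < k \<Longrightarrow> a p' i < \<delta>"
    using \<delta> aboveD(2)[OF p] S(1) C_less[OF m0(1)] unfolding reflecting_def by (meson finite_profile(1))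
  have prof: "profile p' (S n) = profile p (S n)" using p'(1) by (simp add: with_profile_def)
  have main: "a p' i < b (q m) \<and> osc C (a p' i) (b (q m)) =
     osc_on (S m) (e (a p i)) (e (b (q m))) + osc_on (L (a p' i) \<delta>) (e (a p' i)) (e \<delta>)"
    if m: "m \<le> n" and i: "i < k" for m i
  proof -
    let ?\<alpha> = "a p' i" and ?V = "L (a p' i) \<delta>" and ?\<beta> = "b (q m)"
    have \<alpha>: "m0 < ?\<alpha>" "?\<alpha> < \<delta>" "\<delta> < ?\<beta>"
      using p' i aboveD(3)[of p' m0] aboveD(4)[OF q(1)[OF m]] by auto
    have V: "m0 \<le> y" "y < \<delta>" if "y \<in> ?V" for y
      using L_ge(2)[OF \<alpha>(2) m0(1) \<alpha>(1) that] L_subset[of ?\<alpha> \<delta>] that \<alpha>(2) by auto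
    have Sm: "x < \<nu>1" "x \<in> S n" if "x \<in> S m" for x
      using that q(3)[OF m] \<nu>1(2) unfolding S_def by blast+
    have lt: "x < y" if "x \<in> S m" "y \<in> ?V" for x y
      using Sm(1)[OF that(1)] V(1)[OF that(2)] m0(2) by auto
    have "L ?\<alpha> ?\<beta> = ?V \<union> L \<delta> ?\<beta>"
    proof (rule L_concat)
      show "x < ?\<alpha>" if "x \<in> L \<delta> ?\<beta>" for x
        using Sm(1)[of x] that m0(2) \<alpha>(1) by (auto simp: S_def)
      show "x < y" if "x \<in> L \<delta> ?\<beta>" "y \<in> ?V" for x y
        using lt that by (simp add: S_def)
    qed (use \<alpha> in auto)
    then have LL: "L ?\<alpha> ?\<beta> = S m \<union> ?V" by (auto simp: S_def)
    have eq: "e ?\<alpha> x = e (a p i) x" if "x \<in> S m" for x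
      using profile_eqD(2)[OF prof i Sm(2)[OF that]] .
    have "Max (S m) \<in> S m" using q(2)[OF m] finite_L by (simp add: S_def)
    then have "e ?\<alpha> (Max (S m)) > e ?\<beta> (Max (S m))"
      using eq osc(1)[OF m i] by (simp add: S_def)
    then have "osc C ?\<alpha> ?\<beta> = osc_on (S m) (e ?\<alpha>) (e ?\<beta>) + osc_on ?V (e ?\<alpha>) (e ?\<beta>)"
      unfolding osc_eq_osc_on LL using q(2)[OF m] lt
      by (subst osc_on_append) (auto simp: S finite_L S_def)
    moreover have "osc_on (S m) (e ?\<alpha>) (e ?\<beta>) = osc_on (S m) (e (a p i)) (e ?\<beta>)"
      using eq by (intro osc_on_cong S) auto
    moreover have "e ?\<beta> y = e \<delta> y" if "y \<in> ?V" for y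
      using \<nu>2(2)[of ?\<beta> y] V[OF that] m0(2) m by auto
    then have "osc_on ?V (e ?\<alpha>) (e ?\<beta>) = osc_on ?V (e ?\<alpha>) (e \<delta>)"
      by (intro osc_on_cong finite_L) auto
    ultimately show ?thesis using \<alpha> by auto
  qed
  show ?thesis
  proof (intro bexI[of _ p'] exI[of _ q] allI impI conjI)
    show "p' \<in> X" using p'(1) by (simp add: with_profile_def)
    fix m assume m: "m \<le> n"
    show "q m \<in> X" "p' < q m" using aboveD(1,2)[OF q(1)[OF m]] p'(2) by auto
    fix i assume i: "i < k"
    show "a p' i < b (q m)" using main[OF m i] by blast
    show "osc C (a p' i) (b (q m)) = osc C (a p' i) (b (q 0)) + m"
      using main[OF m i] main[OF _ i, of 0] osc(2)[OF m i] by (simp add: S_def)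
  qed
qed

end

section \<open>Simultaneous approximation by powers of independent points of the circle\<close>

lemma unit_circle_norm: "z \<in> unit_circle \<longleftrightarrow> norm z = 1"
proof -
  have eq: "z * cnj z = complex_of_real ((norm z)\<^sup>2)" by (metis complex_norm_square of_real_power)
  have "z \<in> unit_circle \<longleftrightarrow> (norm z)\<^sup>2 = 1"
    unfolding unit_circle_def mem_Collect_eq eq by (rule of_real_eq_1_iff)
  then show ?thesis by (simp add: abs_square_eq_1)
qed

lemma norm_cis_diff_le: "norm (cis x - cis y) \<le> \<bar>x - y\<bar>"
proof -
  have "cis x - cis y = cis y * (cis (x - y) - 1)"
    by (simp add: algebra_simps cis_mult)
  then have "norm (cis x - cis y) = norm (cis (x - y) - 1)"
    by (simp add: norm_mult)
  also have "\<dots> = 2 * \<bar>sin ((x - y) / 2)\<bar>"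
    using dist_exp_i_1[of "x - y"] by (simp add: cis_conv_exp)
  also have "\<dots> \<le> \<bar>x - y\<bar>"
    using abs_sin_x_le_abs_x[of "(x - y) / 2"] by simp
  finally show ?thesis .
qed

text \<open>The inhomogeneous Kronecker theorem for the angles of the \<open>z i\<close>, with the full turn as additional angle;
  multiplicative independence of the \<open>z i\<close> says that these angles are linearly independent over the integers.\<close>

lemma Kronecker_circle:
  fixes z :: "nat \<Rightarrow> complex" and c :: "nat \<Rightarrow> complex"
  assumes z: "\<And>i. i < k \<Longrightarrow> norm (z i) = 1"
    and indep: "\<And>n :: nat \<Rightarrow> int. (\<Prod>i<k. z i powi n i) = 1 \<Longrightarrow> \<forall>i<k. n i = 0"
    and c: "\<And>i. i < k \<Longrightarrow> norm (c i) = 1" and "0 < \<epsilon>"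
  shows "\<exists>j :: int. \<forall>i<k. norm (z i powi j - c i) < \<epsilon>"
proof -
  define \<theta> where "\<theta> i = (if i < k then Arg (z i) / (2 * pi) else 1)" for i
  define \<alpha> where "\<alpha> i = Arg (c i) / (2 * pi)" for i
  have z\<theta>: "z i = cis (2 * pi * \<theta> i)" if "i < k" for i
    using that z[OF that] rcis_cmod_Arg[of "z i"] by (simp add: \<theta>_def rcis_def)
  have c\<alpha>: "c i = cis (2 * pi * \<alpha> i)" if "i < k" for i
    using c[OF that] rcis_cmod_Arg[of "c i"] by (simp add: \<alpha>_def rcis_def)
  have rel: "n i = 0" if n: "(\<Sum>i\<le>k. of_int (n i) * \<theta> i) = 0" and "i \<le> k" for n :: "nat \<Rightarrow> int" and i
  proof -
    have "(\<Prod>i<k. z i powi n i) = (\<Prod>i<k. cis (2 * pi * (of_int (n i) * \<theta> i)))"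
      by (intro prod.cong) (simp_all add: z\<theta> cis_power_int mult_ac)
    also have "\<dots> = cis (\<Sum>i<k. 2 * pi * (of_int (n i) * \<theta> i))"
      by (induction k) (simp_all add: cis_mult)
    also have "(\<Sum>i<k. 2 * pi * (of_int (n i) * \<theta> i)) = 2 * pi * (\<Sum>i<k. of_int (n i) * \<theta> i)"
      by (simp add: sum_distrib_left)
    also have "(\<Sum>i<k. of_int (n i) * \<theta> i) = of_int (- n k)"
      using n by (simp add: lessThan_Suc_atMost[symmetric] \<theta>_def)
    also have "cis (2 * pi * of_int (- n k)) = 1"
      by (rule cis_multiple_2pi) simp
    finally have 0: "\<forall>i<k. n i = 0" by (rule indep)
    then have "n k = 0" using n by (simp add: lessThan_Suc_atMost[symmetric] \<theta>_def)
    with 0 \<open>i \<le> k\<close> show ?thesis by (cases "i = k") auto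
  qed
  have inj: "inj_on \<theta> {..k}"
  proof (rule inj_onI, rule ccontr)
    fix i j assume ij: "i \<in> {..k}" "j \<in> {..k}" "\<theta> i = \<theta> j" "i \<noteq> j"
    define n :: "nat \<Rightarrow> int" where "n l = (if l = i then 1 else if l = j then -1 else 0)" for l
    have "(\<Sum>l\<le>k. of_int (n l) * \<theta> l) = (\<Sum>l\<in>{i, j}. of_int (n l) * \<theta> l)"
      using ij by (intro sum.mono_neutral_right) (auto simp: n_def)
    also have "\<dots> = 0" using ij by (simp add: n_def)
    finally have "n i = 0" using rel ij(1) by blast
    then show False by (simp add: n_def)
  qed
  interpret M: Modules.module "\<lambda>r x. real_of_int r * x"
    by unfold_locales (simp_all add: algebra_simps)
  have "M.independent (\<theta> ` {..k})"
  proof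
    assume "M.dependent (\<theta> ` {..k})"
    then obtain t u v where t: "finite t" "t \<subseteq> \<theta> ` {..k}" "(\<Sum>v\<in>t. real_of_int (u v) * v) = 0" "v \<in> t" "u v \<noteq> 0"
      unfolding M.dependent_explicit by blast
    define n where "n i = (if \<theta> i \<in> t then u (\<theta> i) else 0)" for i
    have "(\<Sum>i\<le>k. of_int (n i) * \<theta> i) = (\<Sum>v\<in>\<theta> ` {..k}. of_int (if v \<in> t then u v else 0) * v)"
      by (simp add: sum.reindex[OF inj] n_def)
    also have "\<dots> = (\<Sum>v\<in>t. real_of_int (u v) * v)"
      by (rule sum.mono_neutral_cong_right) (use t in auto)
    finally have "(\<Sum>i\<le>k. of_int (n i) * \<theta> i) = 0" using t(3) by simp
    moreover obtain i where "i \<le> k" "v = \<theta> i" using t(2,4) by blast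
    ultimately show False using rel[of n i] t(4,5) by (simp add: n_def)
  qed
  moreover have "0 < \<epsilon> / (2 * pi)" using \<open>0 < \<epsilon>\<close> by simp
  moreover have "\<theta> k = 1" by (simp add: \<theta>_def)
  ultimately obtain j m where jm: "\<And>i. i < k \<Longrightarrow> \<bar>of_int j * \<theta> i - of_int (m i) - \<alpha> i\<bar> < \<epsilon> / (2 * pi)"
    using Kronecker_thm_2[OF _ inj, of "\<epsilon> / (2 * pi)" \<alpha>] by blast
  have "norm (z i powi j - c i) < \<epsilon>" if i: "i < k" for i
  proof -
    have "z i powi j = cis (2 * pi * (of_int j * \<theta> i))"
      by (simp add: z\<theta>[OF i] cis_power_int mult_ac)
    also have "\<dots> = cis (2 * pi * (of_int j * \<theta> i)) / cis (2 * pi * of_int (m i))"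
      by (subst cis_multiple_2pi) simp_all
    also have "\<dots> = cis (2 * pi * (of_int j * \<theta> i - of_int (m i)))"
      by (simp add: cis_divide algebra_simps)
    finally have "norm (z i powi j - c i) \<le> \<bar>2 * pi * (of_int j * \<theta> i - of_int (m i)) - 2 * pi * \<alpha> i\<bar>"
      unfolding c\<alpha>[OF i] by (metis norm_cis_diff_le)
    also have "\<dots> = 2 * pi * \<bar>of_int j * \<theta> i - of_int (m i) - \<alpha> i\<bar>"
      by (subst abs_of_pos[of "2 * pi", symmetric], simp, subst abs_mult[symmetric])
        (simp add: right_diff_distrib)
    also have "\<dots> < \<epsilon>" using jm[OF i] by (simp add: field_simps)
    finally show ?thesis .
  qed
  then show ?thesis by blast
qed

lemma finite_net_unit_circle:
  assumes "0 < (\<epsilon>::real)"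
  obtains G :: "complex set" where "finite G" "\<And>x. x \<in> G \<Longrightarrow> norm x = 1"
    "\<And>x. norm x = 1 \<Longrightarrow> \<exists>g\<in>G. norm (x - g) < \<epsilon>"
proof -
  have "compact (sphere (0::complex) 1)" by simp
  then obtain G :: "complex set" where "finite G" and sub: "G \<subseteq> sphere 0 1"
    and cov: "sphere 0 1 \<subseteq> (\<Union>x\<in>G. ball x \<epsilon>)"
  proof (rule compactE_image)
    show "open (ball x \<epsilon>)" for x :: complex by simp
    show "sphere 0 1 \<subseteq> (\<Union>x\<in>sphere (0::complex) 1. ball x \<epsilon>)" using assms by auto
  qed
  show thesis
  proof (rule that[OF \<open>finite G\<close>])
    show "norm x = 1" if "x \<in> G" for x using sub that by auto
    fix x :: complex assume "norm x = 1"
    then have "x \<in> sphere 0 1" by simp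
    then have "x \<in> (\<Union>x\<in>G. ball x \<epsilon>)" using cov by blast
    then show "\<exists>g\<in>G. norm (x - g) < \<epsilon>" by (auto simp: dist_norm norm_minus_commute)
  qed
qed

text \<open>A finite net of targets makes the exponents bounded, independently of the target.\<close>

lemma Kronecker_circle_uniform:
  fixes z :: "nat \<Rightarrow> complex"
  assumes z: "\<And>i. i < k \<Longrightarrow> norm (z i) = 1"
    and indep: "\<And>n :: nat \<Rightarrow> int. (\<Prod>i<k. z i powi n i) = 1 \<Longrightarrow> \<forall>i<k. n i = 0"
    and "0 < \<epsilon>"
  shows "\<exists>K. \<forall>c. (\<forall>i<k. norm (c i) = 1) \<longrightarrow> (\<exists>m\<le>K. \<forall>i<k. norm (z i ^ m - c i) < \<epsilon>)"
proof -
  have "0 < \<epsilon> / 2" using \<open>0 < \<epsilon>\<close> by simp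
  then obtain G :: "complex set" where G: "finite G" "\<And>x. x \<in> G \<Longrightarrow> norm x = 1"
    "\<And>x. norm x = 1 \<Longrightarrow> \<exists>g\<in>G. norm (x - g) < \<epsilon> / 2"
    by (rule finite_net_unit_circle) (rule that; assumption)
  define P where "P = {..<k} \<rightarrow>\<^sub>E G"
  have "\<exists>j :: int. \<forall>i<k. norm (z i powi j - g i) < \<epsilon> / 2" if "g \<in> P" for g
    using that G(2) \<open>0 < \<epsilon>\<close> by (intro Kronecker_circle z indep) (auto simp: P_def PiE_def Pi_def)
  then obtain j where j: "\<And>g i. g \<in> P \<Longrightarrow> i < k \<Longrightarrow> norm (z i powi j g - g i) < \<epsilon> / 2" by metis
  define N where "N = (\<Sum>g\<in>P. nat \<bar>j g\<bar>)"
  have "finite P" unfolding P_def using G(1) by (intro finite_PiE) auto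
  have N: "\<bar>j g\<bar> \<le> int N" if "g \<in> P" for g
  proof -
    have "nat \<bar>j g\<bar> \<le> N"
      unfolding N_def using member_le_sum[OF that, of "\<lambda>g. nat \<bar>j g\<bar>"] \<open>finite P\<close> by simp
    then show ?thesis by linarith
  qed
  \<comment> \<open>Shifting the target by \<open>z i ^ N\<close> makes the integer exponent nonnegative.\<close>
  show ?thesis
  proof (rule exI[of _ "2 * N"], intro allI impI)
    fix c :: "nat \<Rightarrow> complex" assume c: "\<forall>i<k. norm (c i) = 1"
    define c' where "c' i = c i / z i ^ N" for i
    have "\<forall>i. i < k \<longrightarrow> (\<exists>g\<in>G. norm (c' i - g) < \<epsilon> / 2)"
      using G(3) c z by (simp add: c'_def norm_divide norm_power)
    then obtain g0 where g0: "\<And>i. i < k \<Longrightarrow> g0 i \<in> G \<and> norm (c' i - g0 i) < \<epsilon> / 2" by metis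
    define g where "g = restrict g0 {..<k}"
    have g: "g \<in> P" "\<And>i. i < k \<Longrightarrow> norm (c' i - g i) < \<epsilon> / 2"
      using g0 by (auto simp: g_def P_def)
    show "\<exists>m\<le>2 * N. \<forall>i<k. norm (z i ^ m - c i) < \<epsilon>"
    proof (intro exI[of _ "nat (j g + int N)"] conjI allI impI)
      show "nat (j g + int N) \<le> 2 * N" using N[OF g(1)] by linarith
      fix i assume i: "i < k"
      have z0: "z i \<noteq> 0" using z[OF i] by auto
      have "z i ^ nat (j g + int N) = z i powi (j g + int N)"
        using N[OF g(1)] by (simp add: power_int_def)
      also have "\<dots> = z i powi j g * z i ^ N" using z0 by (simp add: power_int_add)
      finally have "z i ^ nat (j g + int N) - c i = (z i powi j g - c' i) * z i ^ N"
        using z0 by (simp add: c'_def field_simps)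
      then have "norm (z i ^ nat (j g + int N) - c i) = norm (z i powi j g - c' i)"
        using z[OF i] by (simp add: norm_mult norm_power)
      also have "\<dots> \<le> norm (z i powi j g - g i) + norm (c' i - g i)"
        using norm_triangle_ineq4[of "z i powi j g - g i" "c' i - g i"] by simp
      also have "\<dots> < \<epsilon>" using j[OF g(1) i] g(2)[OF i] by simp
      finally show "norm (z i ^ nat (j g + int N) - c i) < \<epsilon>" .
    qed
  qed
qed

section \<open>Refining uncountable families of finite sets\<close>

text \<open>A weak form of the Delta-system lemma: the petals \<open>s x - F\<close> need not be disjoint, they only have to
  escape every countable level. If some level is met by uncountably many \<open>s x\<close>, then one of its countably many
  elements belongs to uncountably many \<open>s x\<close> and is moved to the root.\<close>

lemma uncountable_refine_petals:
  fixes s :: "omega1 \<Rightarrow> omega1 set"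
  assumes "uncountable X" "\<And>x. x \<in> X \<Longrightarrow> finite (s x) \<and> card (s x) = n"
  shows "\<exists>F X'. X' \<subseteq> X \<and> uncountable X' \<and> (\<forall>x\<in>X'. F \<subseteq> s x) \<and>
      (\<forall>\<nu>. countable {x \<in> X'. \<exists>\<alpha>\<in>s x - F. \<alpha> \<le> \<nu>})"
  using assms
proof (induction n arbitrary: X s)
  case 0
  then have "s x = {}" if "x \<in> X" for x using that by (metis card_0_eq)
  then have "{x \<in> X. \<exists>\<alpha>\<in>s x - {}. \<alpha> \<le> \<nu>} = {}" for \<nu> by auto
  then have "X \<subseteq> X \<and> uncountable X \<and> (\<forall>x\<in>X. {} \<subseteq> s x) \<and>
      (\<forall>\<nu>. countable {x \<in> X. \<exists>\<alpha>\<in>s x - {}. \<alpha> \<le> \<nu>})"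
    using 0(1) by (simp only: countable_empty) simp
  then show ?case by (intro exI; assumption)
next
  case (Suc n)
  show ?case
  proof (cases "\<forall>\<nu>. countable {x \<in> X. \<exists>\<alpha>\<in>s x. \<alpha> \<le> \<nu>}")
    case True
    then have "X \<subseteq> X \<and> uncountable X \<and> (\<forall>x\<in>X. {} \<subseteq> s x) \<and>
      (\<forall>\<nu>. countable {x \<in> X. \<exists>\<alpha>\<in>s x - {}. \<alpha> \<le> \<nu>})"
      using Suc.prems(1) by simp
    then show ?thesis by (intro exI; assumption)
  next
    case False
    then obtain \<nu> where \<nu>: "uncountable {x \<in> X. \<exists>\<alpha>\<in>s x. \<alpha> \<le> \<nu>}" by blast
    have "{x \<in> X. \<exists>\<alpha>\<in>s x. \<alpha> \<le> \<nu>} = (\<Union>\<alpha>\<in>{..\<nu>}. {x \<in> X. \<alpha> \<in> s x})" by auto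
    then obtain \<alpha> where \<alpha>: "uncountable {x \<in> X. \<alpha> \<in> s x}"
      using \<nu> countable_atMost_omega1 by (metis (no_types, lifting) countable_UN)
    have "\<exists>F X'. X' \<subseteq> {x \<in> X. \<alpha> \<in> s x} \<and> uncountable X' \<and> (\<forall>x\<in>X'. F \<subseteq> s x - {\<alpha>}) \<and>
      (\<forall>\<nu>. countable {x \<in> X'. \<exists>\<beta>\<in>s x - {\<alpha>} - F. \<beta> \<le> \<nu>})"
      using Suc.prems(2) by (intro Suc.IH \<alpha>) auto
    then obtain F X' where *: "X' \<subseteq> {x \<in> X. \<alpha> \<in> s x} \<and> uncountable X' \<and> (\<forall>x\<in>X'. F \<subseteq> s x - {\<alpha>}) \<and>
      (\<forall>\<nu>. countable {x \<in> X'. \<exists>\<beta>\<in>s x - {\<alpha>} - F. \<beta> \<le> \<nu>})"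
      by (elim exE) (rule that)
    have "s x - {\<alpha>} - F = s x - insert \<alpha> F" for x by auto
    with * have "countable {x \<in> X'. \<exists>\<beta>\<in>s x - insert \<alpha> F. \<beta> \<le> \<nu>}" for \<nu> by simp
    moreover have "X' \<subseteq> X" "\<forall>x\<in>X'. insert \<alpha> F \<subseteq> s x" using * by auto
    ultimately have "X' \<subseteq> X \<and> uncountable X' \<and> (\<forall>x\<in>X'. insert \<alpha> F \<subseteq> s x) \<and>
      (\<forall>\<nu>. countable {x \<in> X'. \<exists>\<beta>\<in>s x - insert \<alpha> F. \<beta> \<le> \<nu>})"
      using * by blast
    then show ?thesis by (intro exI; assumption)
  qed
qed

section \<open>Moore's space is hereditarily Lindelof\<close>

locale moore_points = ladder_system C
  for C :: "omega1 \<Rightarrow> omega1 set" +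
  fixes z :: "omega1 \<Rightarrow> complex"
  assumes z_circle: "range z \<subseteq> unit_circle"
    and z_independent: "rationally_independent z"
begin

abbreviation "w \<equiv> moore_w C z"

lemma norm_z: "norm (z \<alpha>) = 1"
  using z_circle unit_circle_norm by blast

lemma norm_w: "norm (w \<beta> \<alpha>) = 1"
  using moore_w_in_unit_circle[OF z_circle] unit_circle_norm by blast

lemma z_power_neq_1: "z \<alpha> ^ Suc m \<noteq> 1"
proof
  assume "z \<alpha> ^ Suc m = 1"
  then have "(\<Prod>\<beta>\<in>{\<alpha>}. z \<beta> powi int (Suc m)) = 1" by (simp add: power_int_def nat_add_distrib)
  then have "\<forall>\<beta>\<in>{\<alpha>}. int (Suc m) = 0"
    using z_independent[unfolded rationally_independent_def, rule_format, of "{\<alpha>}" "\<lambda>_. int (Suc m)"]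
    by blast
  then show False by simp
qed

lemma z_family_independent:
  fixes n :: "nat \<Rightarrow> int"
  assumes "inj_on f {..<k}" "(\<Prod>i<k. z (f i) powi n i) = 1"
  shows "\<forall>i<k. n i = 0"
proof -
  define n' where "n' = n \<circ> inv_into {..<k} f"
  have n': "n' (f i) = n i" if "i < k" for i
    using that assms(1) by (simp add: n'_def)
  have "(\<Prod>\<alpha>\<in>f ` {..<k}. z \<alpha> powi n' \<alpha>) = (\<Prod>i<k. z (f i) powi n i)"
    using n' by (simp add: prod.reindex[OF assms(1)])
  then have "\<forall>\<alpha>\<in>f ` {..<k}. n' \<alpha> = 0"
    using z_independent[unfolded rationally_independent_def, rule_format, of "f ` {..<k}" n'] assms(2)
    by simp
  then show ?thesis using n' by auto
qed

lemma w_inject: "w \<beta> = w \<beta>' \<longleftrightarrow> \<beta> = \<beta>'"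
proof
  have *: "w \<beta> \<noteq> w \<beta>'" if "\<beta> < \<beta>'" for \<beta> \<beta>'
  proof -
    have "w \<beta> \<beta> = 1" "w \<beta>' \<beta> \<noteq> 1"
      using that z_power_neq_1[of \<beta> "osc C \<beta> \<beta>'"] by (simp_all add: moore_w_def osc_col_def)
    then show ?thesis by auto
  qed
  show "\<beta> = \<beta>'" if "w \<beta> = w \<beta>'"
    using *[of \<beta> \<beta>'] *[of \<beta>' \<beta>] that by (metis linorder_neqE)
qed simp

text \<open>Thinning out makes the following independent of \<open>\<gamma>\<close>: a lower bound \<open>\<eta>\<close> for the radii, the root \<open>F\<close> of the
  supports, the approximate values on the root, and the number \<open>N\<close> of consecutive exponents after which the
  powers of \<open>z\<close> on a petal come \<open>\<eta>\<close>-close to any target. Petals then satisfy the hypotheses of the oscillation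
  theorem, and one of the \<open>N + 1\<close> shifts it provides hits the target.\<close>

theorem no_right_separated_sequence:
  fixes x :: "omega1 \<Rightarrow> omega1" and s :: "omega1 \<Rightarrow> omega1 set" and \<epsilon> :: "omega1 \<Rightarrow> real"
  assumes x: "\<And>\<gamma>. \<gamma> \<le> x \<gamma>" and s: "\<And>\<gamma>. finite (s \<gamma>)" and \<epsilon>: "\<And>\<gamma>. 0 < \<epsilon> \<gamma>"
  shows "\<exists>\<gamma>' \<gamma>. \<gamma>' < \<gamma> \<and> (\<forall>\<alpha>\<in>s \<gamma>'. norm (w (x \<gamma>) \<alpha> - w (x \<gamma>') \<alpha>) < \<epsilon> \<gamma>')"
proof -
  have "\<forall>\<gamma>. \<exists>j. inverse (real (Suc j)) < \<epsilon> \<gamma>" using reals_Archimedean[OF \<epsilon>] by blast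
  then obtain j where j: "\<And>\<gamma>. inverse (real (Suc (j \<gamma>))) < \<epsilon> \<gamma>" by metis
  obtain v where v: "uncountable {\<gamma> \<in> UNIV. (j \<gamma>, card (s \<gamma>)) = v}"
    by (rule uncountable_fiber[OF uncountable_omega1, of "\<lambda>\<gamma>. (j \<gamma>, card (s \<gamma>))"]) auto
  define X1 where "X1 = {\<gamma> \<in> UNIV. (j \<gamma>, card (s \<gamma>)) = v}"
  define \<eta> where "\<eta> = inverse (real (Suc (fst v)))"
  have \<eta>: "0 < \<eta>" by (simp add: \<eta>_def)
  have X1: "\<eta> < \<epsilon> \<gamma>" "card (s \<gamma>) = snd v" if "\<gamma> \<in> X1" for \<gamma>
    using that j[of \<gamma>] by (auto simp: X1_def \<eta>_def)
  have "\<exists>F X'. X' \<subseteq> X1 \<and> uncountable X' \<and> (\<forall>x\<in>X'. F \<subseteq> s x) \<and>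
      (\<forall>\<nu>. countable {x \<in> X'. \<exists>\<alpha>\<in>s x - F. \<alpha> \<le> \<nu>})"
  proof (rule uncountable_refine_petals)
    show "uncountable X1" using v unfolding X1_def .
    show "finite (s x) \<and> card (s x) = snd v" if "x \<in> X1" for x using s X1(2)[OF that] by blast
  qed
  then obtain F X2 where X2: "X2 \<subseteq> X1" "uncountable X2" "\<forall>x\<in>X2. F \<subseteq> s x"
    "\<forall>\<nu>. countable {x \<in> X2. \<exists>\<alpha>\<in>s x - F. \<alpha> \<le> \<nu>}"
    by (elim exE conjE) (rule that; assumption)
  have "X2 \<noteq> {}" using X2(2) by auto
  then have F: "finite F" using X2(3) s finite_subset by (metis all_not_in_conv)
  have "0 < \<eta> / 2" using \<eta> by simp
  then obtain G :: "complex set" where G: "finite G" "\<And>x. norm x = 1 \<Longrightarrow> \<exists>g\<in>G. norm (x - g) < \<eta> / 2"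
    by (rule finite_net_unit_circle) (rule that; assumption)
  have "\<exists>g\<in>G. norm (w (x \<gamma>) \<alpha> - g) < \<eta> / 2" for \<gamma> \<alpha> using G(2) norm_w by blast
  then obtain r where r: "\<And>\<gamma> \<alpha>. r \<gamma> \<alpha> \<in> G" "\<And>\<gamma> \<alpha>. norm (w (x \<gamma>) \<alpha> - r \<gamma> \<alpha>) < \<eta> / 2" by metis
  have "(\<lambda>\<gamma>. restrict (r \<gamma>) F) ` X2 \<subseteq> F \<rightarrow>\<^sub>E G" using r(1) by auto
  moreover have "finite (F \<rightarrow>\<^sub>E G)" using F G(1) by (intro finite_PiE) auto
  ultimately have "countable ((\<lambda>\<gamma>. restrict (r \<gamma>) F) ` X2)"
    using countable_finite finite_subset by blast
  with X2(2) obtain u where u: "uncountable {\<gamma> \<in> X2. restrict (r \<gamma>) F = u}"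
    by (rule uncountable_fiber)
  define X3 where "X3 = {\<gamma> \<in> X2. restrict (r \<gamma>) F = u}"
  have root: "norm (w (x \<gamma>) \<alpha> - w (x \<gamma>') \<alpha>) < \<eta>" if "\<gamma> \<in> X3" "\<gamma>' \<in> X3" "\<alpha> \<in> F" for \<gamma> \<gamma>' \<alpha>
  proof -
    have "restrict (r \<gamma>) F = u" "restrict (r \<gamma>') F = u" using that by (simp_all add: X3_def)
    then have "r \<gamma> \<alpha> = u \<alpha>" "r \<gamma>' \<alpha> = u \<alpha>" using \<open>\<alpha> \<in> F\<close> by (metis restrict_apply')+
    then have "norm (w (x \<gamma>) \<alpha> - u \<alpha>) < \<eta> / 2" "norm (w (x \<gamma>') \<alpha> - u \<alpha>) < \<eta> / 2"
      using r(2)[of \<gamma> \<alpha>] r(2)[of \<gamma>' \<alpha>] by simp_all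
    then show ?thesis
      using norm_triangle_ineq4[of "w (x \<gamma>) \<alpha> - u \<alpha>" "w (x \<gamma>') \<alpha> - u \<alpha>"] by simp
  qed
  define k where "k = snd v - card F"
  have "\<exists>h. \<gamma> \<in> X3 \<longrightarrow> bij_betw h {..<k} (s \<gamma> - F)" for \<gamma>
  proof (cases "\<gamma> \<in> X3")
    case True
    then have "\<gamma> \<in> X1" "F \<subseteq> s \<gamma>" using X2 by (auto simp: X3_def)
    then have "card (s \<gamma> - F) = k" using X1(2) F by (simp add: card_Diff_subset k_def)
    then show ?thesis using ex_bij_betw_nat_finite[of "s \<gamma> - F"] s by (auto simp: atLeast0LessThan)
  qed simp
  then obtain a where a: "\<And>\<gamma>. \<gamma> \<in> X3 \<Longrightarrow> bij_betw (a \<gamma>) {..<k} (s \<gamma> - F)" by metis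
  have "\<exists>K. \<gamma> \<in> X3 \<longrightarrow> (\<forall>c. (\<forall>i<k. norm (c i) = 1) \<longrightarrow> (\<exists>m\<le>K. \<forall>i<k. norm (z (a \<gamma> i) ^ m - c i) < \<eta>))" for \<gamma>
  proof (cases "\<gamma> \<in> X3")
    case True
    have "\<exists>K. \<forall>c. (\<forall>i<k. norm (c i) = 1) \<longrightarrow> (\<exists>m\<le>K. \<forall>i<k. norm (z (a \<gamma> i) ^ m - c i) < \<eta>)"
      by (rule Kronecker_circle_uniform[OF norm_z z_family_independent[OF bij_betw_imp_inj_on[OF a[OF True]]] \<eta>])
    then show ?thesis by blast
  qed simp
  then obtain K where K: "\<And>\<gamma> c. \<gamma> \<in> X3 \<Longrightarrow> \<forall>i<k. norm (c i) = 1 \<Longrightarrow>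
      \<exists>m\<le>K \<gamma>. \<forall>i<k. norm (z (a \<gamma> i) ^ m - c i) < \<eta>" by metis
  obtain N where N: "uncountable {\<gamma> \<in> X3. K \<gamma> = N}"
    using u unfolding X3_def[symmetric] by (rule uncountable_fiber) auto
  define X4 where "X4 = {\<gamma> \<in> X3. K \<gamma> = N}"
  interpret unbounded_family C X4 k a x
  proof
    show "uncountable X4" using N by (simp add: X4_def)
    show "countable {p \<in> X4. \<exists>i<k. a p i \<le> \<nu>}" for \<nu>
    proof (rule countable_subset)
      show "{p \<in> X4. \<exists>i<k. a p i \<le> \<nu>} \<subseteq> {x \<in> X2. \<exists>\<alpha>\<in>s x - F. \<alpha> \<le> \<nu>}"
      proof
        fix p assume "p \<in> {p \<in> X4. \<exists>i<k. a p i \<le> \<nu>}"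
        then obtain i where p: "p \<in> X3" "i < k" "a p i \<le> \<nu>" by (auto simp: X4_def)
        then have "a p i \<in> s p - F" using bij_betwE[OF a] by blast
        then show "p \<in> {x \<in> X2. \<exists>\<alpha>\<in>s x - F. \<alpha> \<le> \<nu>}" using p by (auto simp: X3_def)
      qed
      show "countable {x \<in> X2. \<exists>\<alpha>\<in>s x - F. \<alpha> \<le> \<nu>}" using X2(4) by blast
    qed
    show "countable {p \<in> X4. x p \<le> \<nu>}" for \<nu>
      using x by (intro bounded_countable_omega1[of _ \<nu>]) (auto intro: order_trans)
  qed
  obtain p q where p: "p \<in> X4" and q: "\<And>m. m \<le> N \<Longrightarrow> q m \<in> X4" "\<And>m. m \<le> N \<Longrightarrow> p < q m"
    and pq: "\<And>m i. m \<le> N \<Longrightarrow> i < k \<Longrightarrow> a p i < x (q m)"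
      "\<And>m i. m \<le> N \<Longrightarrow> i < k \<Longrightarrow> osc C (a p i) (x (q m)) = osc C (a p i) (x (q 0)) + m"
    using oscillation_attains_shifts[of N] by blast
  have pX: "p \<in> X3" "K p = N" using p by (auto simp: X4_def)
  define R where "R i = osc C (a p i) (x (q 0)) + 1" for i
  (* On the petal the m-th point has the value z ^ R * z ^ m; dividing the target by z ^ R
     leaves a condition on z ^ m alone. *)
  define c where "c i = w (x p) (a p i) * cnj (z (a p i)) ^ R i" for i
  have "\<forall>i<k. norm (c i) = 1" by (simp add: c_def norm_mult norm_power norm_w norm_z)
  then obtain m where m: "m \<le> N" "\<And>i. i < k \<Longrightarrow> norm (z (a p i) ^ m - c i) < \<eta>"
    using K[OF pX(1)] pX(2) by blast
  have "norm (w (x (q m)) \<alpha> - w (x p) \<alpha>) < \<epsilon> p" if \<alpha>: "\<alpha> \<in> s p" for \<alpha>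
  proof -
    have "norm (w (x (q m)) \<alpha> - w (x p) \<alpha>) < \<eta>"
    proof (cases "\<alpha> \<in> F")
      case True
      have "q m \<in> X3" using q(1)[OF m(1)] by (simp add: X4_def)
      then show ?thesis using True pX(1) by (intro root)
    next
      case False
      then obtain i where i: "i < k" "\<alpha> = a p i"
        using \<alpha> bij_betw_imp_surj_on[OF a[OF pX(1)]] by blast
      have "z \<alpha> ^ R i * cnj (z \<alpha>) ^ R i = 1"
        using norm_z[of \<alpha>] unit_circle_norm[of "z \<alpha>"]
        by (simp add: power_mult_distrib[symmetric] unit_circle_def)
      then have "z \<alpha> ^ R i * c i = w (x p) \<alpha>"
        by (simp add: c_def i(2) mult.left_commute)
      moreover have "w (x (q m)) \<alpha> = z \<alpha> ^ R i * z \<alpha> ^ m"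
        using pq[OF m(1) i(1)] by (simp add: moore_w_def osc_col_def R_def i(2) power_add)
      ultimately have "w (x (q m)) \<alpha> - w (x p) \<alpha> = z \<alpha> ^ R i * (z \<alpha> ^ m - c i)"
        by (simp add: right_diff_distrib)
      then show ?thesis using m(2)[OF i(1)] i(2) by (simp add: norm_mult norm_power norm_z)
    qed
    also have "\<eta> < \<epsilon> p" using X1(1) X2(1) pX(1) by (auto simp: X3_def)
    finally show ?thesis .
  qed
  then show ?thesis using q(2)[OF m(1)] by blast
qed

text \<open>If no countable subfamily covers, then recursion yields a sequence of length \<open>\<omega>\<^sub>1\<close> in which no point lies in
  the neighbourhood of an earlier one. Avoiding also the neighbourhoods of all points with index in \<open>Y\<close> up to \<open>\<gamma>\<close>
  makes the sequence escape every countable level.\<close>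

theorem countable_subcover:
  fixes s :: "omega1 \<Rightarrow> omega1 set" and \<epsilon> :: "omega1 \<Rightarrow> real"
  assumes s: "\<And>\<beta>. finite (s \<beta>)" and \<epsilon>: "\<And>\<beta>. 0 < \<epsilon> \<beta>"
  shows "\<exists>Z\<subseteq>Y. countable Z \<and> (\<forall>\<delta>\<in>Y. \<exists>\<beta>\<in>Z. \<forall>\<alpha>\<in>s \<beta>. norm (w \<delta> \<alpha> - w \<beta> \<alpha>) < \<epsilon> \<beta>)"
proof (rule ccontr)
  assume contra: "\<not> ?thesis"
  have no: "\<exists>\<delta>\<in>Y. \<forall>\<beta>\<in>Z. \<not> (\<forall>\<alpha>\<in>s \<beta>. norm (w \<delta> \<alpha> - w \<beta> \<alpha>) < \<epsilon> \<beta>)" if "Z \<subseteq> Y" "countable Z" for Z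
  proof (rule ccontr)
    assume neg: "\<not> ?thesis"
    have "\<forall>\<delta>\<in>Y. \<exists>\<beta>\<in>Z. \<forall>\<alpha>\<in>s \<beta>. norm (w \<delta> \<alpha> - w \<beta> \<alpha>) < \<epsilon> \<beta>"
      using neg by (simp only: bex_simps ball_simps not_not)
    with that have "Z \<subseteq> Y \<and> countable Z \<and> (\<forall>\<delta>\<in>Y. \<exists>\<beta>\<in>Z. \<forall>\<alpha>\<in>s \<beta>. norm (w \<delta> \<alpha> - w \<beta> \<alpha>) < \<epsilon> \<beta>)"
      by (intro conjI)
    then show False using contra by (elim notE) (rule exI)
  qed
  define P where "P f \<gamma> \<delta> \<longleftrightarrow> \<delta> \<in> Y \<and> \<gamma> \<le> \<delta> \<and>
    (\<forall>\<gamma>'<\<gamma>. \<not> (\<forall>\<alpha>\<in>s (f \<gamma>'). norm (w \<delta> \<alpha> - w (f \<gamma>') \<alpha>) < \<epsilon> (f \<gamma>')))" for f \<gamma> \<delta>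
  have "\<exists>x. \<forall>\<gamma>. P x \<gamma> (x \<gamma>)"
  proof (rule dependent_wellorder_choice)
    show "P f \<gamma> \<delta> = P g \<gamma> \<delta>" if "\<And>y. y < \<gamma> \<Longrightarrow> f y = g y" for \<delta> f g \<gamma>
      using that by (simp add: P_def)
  next
    fix \<gamma> f assume f: "\<And>y. y < \<gamma> \<Longrightarrow> P f y (f y)"
    define Z where "Z = f ` {..<\<gamma>} \<union> (Y \<inter> {..\<gamma>})"
    have "Z \<subseteq> Y" using f by (auto simp: Z_def P_def)
    moreover have "countable Z"
      using countable_lessThan_omega1 countable_atMost_omega1 by (simp add: Z_def)
    ultimately have "\<exists>\<delta>\<in>Y. \<forall>\<beta>\<in>Z. \<not> (\<forall>\<alpha>\<in>s \<beta>. norm (w \<delta> \<alpha> - w \<beta> \<alpha>) < \<epsilon> \<beta>)"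
      by (rule no)
    then obtain \<delta> where \<delta>: "\<delta> \<in> Y" "\<And>\<beta>. \<beta> \<in> Z \<Longrightarrow> \<not> (\<forall>\<alpha>\<in>s \<beta>. norm (w \<delta> \<alpha> - w \<beta> \<alpha>) < \<epsilon> \<beta>)"
      by (elim bexE) (rule that; blast)
    have "\<delta> \<notin> Z" using \<delta>(2)[of \<delta>] \<epsilon> by auto
    then have "\<gamma> \<le> \<delta>" using \<delta>(1) by (auto simp: Z_def)
    then show "\<exists>\<delta>. P f \<gamma> \<delta>" using \<delta> by (intro exI[of _ \<delta>]) (simp add: P_def Z_def)
  qed
  then obtain x where x: "\<And>\<gamma>. P x \<gamma> (x \<gamma>)" by blast
  have "\<exists>\<gamma>' \<gamma>. \<gamma>' < \<gamma> \<and> (\<forall>\<alpha>\<in>(s \<circ> x) \<gamma>'. norm (w (x \<gamma>) \<alpha> - w (x \<gamma>') \<alpha>) < (\<epsilon> \<circ> x) \<gamma>')"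
    by (rule no_right_separated_sequence) (use x s \<epsilon> in \<open>auto simp: P_def\<close>)
  then show False using x unfolding P_def comp_def by blast
qed

section \<open>Cones and basic neighbourhoods\<close>

lemma uncountable_cone:
  "\<exists>\<beta>. uncountable {\<delta>. \<forall>\<alpha><\<gamma>. w \<delta> \<alpha> = w \<beta> \<alpha>}"
proof -
  have "\<exists>l. \<gamma> \<le> \<beta> \<longrightarrow> l \<in> lists {S. finite S \<and> S \<subseteq> {..<\<gamma>}} \<and> walk_code \<gamma> l \<beta>" for \<beta>
    using ex_walk_code by blast
  then obtain l where l: "\<And>\<beta>. \<gamma> \<le> \<beta> \<Longrightarrow> l \<beta> \<in> lists {S. finite S \<and> S \<subseteq> {..<\<gamma>}}"
    "\<And>\<beta>. \<gamma> \<le> \<beta> \<Longrightarrow> walk_code \<gamma> (l \<beta>) \<beta>" by metis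
  have "countable (lists {S. finite S \<and> S \<subseteq> {..<\<gamma>}})"
    by (intro countable_lists countable_Collect_finite_subset countable_lessThan_omega1)
  moreover have "l ` {\<gamma>..} \<subseteq> lists {S. finite S \<and> S \<subseteq> {..<\<gamma>}}" using l(1) by auto
  ultimately have "countable (l ` {\<gamma>..})" using countable_subset by blast
  then have "countable ((\<lambda>\<beta>. restrict (w \<beta>) {..<\<gamma>}) ` {\<gamma>..})"
  proof (rule countable_image_factor)
    fix \<beta> \<beta>' assume *: "\<beta> \<in> {\<gamma>..}" "\<beta>' \<in> {\<gamma>..}" "l \<beta> = l \<beta>'"
    have "w \<beta> \<alpha> = w \<beta>' \<alpha>" if "\<alpha> < \<gamma>" for \<alpha>
    proof -
      have det: "L \<zeta> \<beta> = L \<zeta> \<beta>'" "e \<beta> \<zeta> = e \<beta>' \<zeta>" if "\<zeta> < \<gamma>" for \<zeta>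
        using walk_code_determines[OF l(2)[of \<beta>], of \<beta>' \<zeta>] l(2)[of \<beta>'] * that by auto
      have "\<zeta> < \<gamma>" if "\<zeta> \<in> L \<alpha> \<beta>'" for \<zeta>
        using L_subset[of \<alpha> \<beta>'] that \<open>\<alpha> < \<gamma>\<close> by auto
      then have "osc C \<alpha> \<beta> = osc C \<alpha> \<beta>'"
        unfolding osc_eq_osc_on det(1)[OF \<open>\<alpha> < \<gamma>\<close>]
        using det(2) by (intro osc_on_cong finite_L) auto
      moreover have "\<alpha> < \<beta>" "\<alpha> < \<beta>'" using *(1,2) that by auto
      ultimately show ?thesis by (simp add: moore_w_def osc_col_def)
    qed
    then show "restrict (w \<beta>) {..<\<gamma>} = restrict (w \<beta>') {..<\<gamma>}" by (auto simp: restrict_def)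
  qed
  moreover have "uncountable {\<gamma>..}"
    by (rule uncountable_cofinal_omega1) (metis atLeast_iff max.cobounded1 max.cobounded2)
  ultimately obtain v where v: "uncountable {\<beta> \<in> {\<gamma>..}. restrict (w \<beta>) {..<\<gamma>} = v}"
    by (metis uncountable_fiber)
  then have "{\<beta> \<in> {\<gamma>..}. restrict (w \<beta>) {..<\<gamma>} = v} \<noteq> {}" by (metis countable_empty)
  then obtain \<beta> where \<beta>: "restrict (w \<beta>) {..<\<gamma>} = v" by blast
  have sub: "{\<beta> \<in> {\<gamma>..}. restrict (w \<beta>) {..<\<gamma>} = v} \<subseteq> {\<delta>. \<forall>\<alpha><\<gamma>. w \<delta> \<alpha> = w \<beta> \<alpha>}"
  proof safe
    fix \<delta> \<alpha> assume "v = restrict (w \<delta>) {..<\<gamma>}" "\<alpha> < \<gamma>"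
    then show "w \<delta> \<alpha> = w \<beta> \<alpha>" using \<beta> by (metis lessThan_iff restrict_apply')
  qed
  have "uncountable {\<delta>. \<forall>\<alpha><\<gamma>. w \<delta> \<alpha> = w \<beta> \<alpha>}"
    using v countable_subset[OF sub] by (rule contrapos_nn)
  then show ?thesis by (rule exI)
qed

lemma open_contains_basic:
  assumes "openin (moore_space C z) U" "w \<beta> \<in> U"
  shows "\<exists>s \<epsilon>. finite s \<and> 0 < \<epsilon> \<and> (\<forall>\<delta>. (\<forall>\<alpha>\<in>s. norm (w \<delta> \<alpha> - w \<beta> \<alpha>) < \<epsilon>) \<longrightarrow> w \<delta> \<in> U)"
proof -
  obtain V where V: "openin (product_topology (\<lambda>_. top_of_set unit_circle) UNIV) V" "U = V \<inter> range w"
    using assms(1) unfolding moore_space_def openin_subtopology by blast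
  then obtain B where B: "finite {i. B i \<noteq> unit_circle}"
    "\<And>i. openin (top_of_set unit_circle) (B i)" "w \<beta> \<in> Pi\<^sub>E UNIV B" "Pi\<^sub>E UNIV B \<subseteq> V"
  proof -
    have "w \<beta> \<in> V" using assms(2) V(2) by blast
    then obtain B where "finite {i \<in> UNIV. B i \<noteq> topspace (top_of_set unit_circle)}"
      "\<forall>i\<in>UNIV. openin (top_of_set unit_circle) (B i)" "w \<beta> \<in> Pi\<^sub>E UNIV B" "Pi\<^sub>E UNIV B \<subseteq> V"
      using V(1)[unfolded openin_product_topology_alt, THEN bspec, OF \<open>w \<beta> \<in> V\<close>]
      by (elim exE conjE) (rule that; assumption)
    then show ?thesis using that[of B] by simp
  qed
  have "\<exists>\<epsilon>>0. \<forall>y\<in>unit_circle. norm (y - w \<beta> i) < \<epsilon> \<longrightarrow> y \<in> B i" for i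
  proof -
    obtain T where "open T" "B i = unit_circle \<inter> T" using B(2)[of i] by (auto simp: openin_open)
    moreover have "w \<beta> i \<in> B i" using B(3) by auto
    ultimately show ?thesis by (metis IntD2 IntI open_dist dist_norm)
  qed
  then obtain \<epsilon> where \<epsilon>: "\<And>i. 0 < \<epsilon> i" "\<And>i y. y \<in> unit_circle \<Longrightarrow> norm (y - w \<beta> i) < \<epsilon> i \<Longrightarrow> y \<in> B i" by metis
  define s where "s = {i. B i \<noteq> unit_circle}"
  define \<eta> where "\<eta> = Min (insert 1 (\<epsilon> ` s))"
  have \<eta>: "0 < \<eta>" "\<And>i. i \<in> s \<Longrightarrow> \<eta> \<le> \<epsilon> i" using B(1) \<epsilon>(1) by (auto simp: \<eta>_def s_def)
  have "w \<delta> \<in> U" if "\<forall>\<alpha>\<in>s. norm (w \<delta> \<alpha> - w \<beta> \<alpha>) < \<eta>" for \<delta>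
  proof -
    have "w \<delta> i \<in> B i" for i
      using that \<epsilon>(2)[of "w \<delta> i" i] \<eta>(2)[of i] moore_w_in_unit_circle[OF z_circle, of C \<delta> i]
      by (cases "i \<in> s") (force, simp add: s_def)
    then show ?thesis using B(4) V(2) by auto
  qed
  then show ?thesis using \<eta>(1) B(1) unfolding s_def by blast
qed

end

section \<open>A decreasing sequence without small open expansions\<close>

text \<open>All triples \<open>(\<gamma>, \<beta>, n)\<close> are listed in type \<open>\<omega>\<^sub>1\<close>, and for each one a new element of \<open>X \<gamma> \<beta>\<close> is chosen and
  given the value \<open>n\<close>; only countably many elements have been used before.\<close>

lemma ex_unbounded_on_uncountable_sets:
  fixes X :: "omega1 \<Rightarrow> omega1 \<Rightarrow> omega1 set"
  shows "\<exists>f :: omega1 \<Rightarrow> nat. \<forall>\<gamma> \<beta> n. uncountable (X \<gamma> \<beta>) \<longrightarrow> (\<exists>x\<in>X \<gamma> \<beta>. n \<le> f x)"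
proof -
  have inf: "infinite (UNIV :: omega1 set)" using uncountable_omega1 countable_finite by blast
  obtain t :: "omega1 \<Rightarrow> omega1 \<times> omega1" where t: "surj t"
  proof -
    have "(card_of (UNIV \<times> UNIV :: (omega1 \<times> omega1) set), card_of (UNIV :: omega1 set)) \<in> ordIso"
      by (rule card_of_Times_same_infinite[OF inf])
    then obtain h :: "omega1 \<times> omega1 \<Rightarrow> omega1" where "bij_betw h (UNIV \<times> UNIV) UNIV"
      using card_of_ordIso by blast
    then have "surj (inv h)" by (metis UNIV_Times_UNIV bij_betw_def inj_imp_surj_inv)
    then show ?thesis using that by blast
  qed
  obtain c :: "omega1 \<Rightarrow> nat" where c: "surj c"
  proof -
    obtain h :: "nat \<Rightarrow> omega1" where "inj h"
      using infinite_countable_subset[OF inf] by blast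
    then show ?thesis using that inj_imp_surj_inv by blast
  qed
  define g where "g \<xi> = (fst (t \<xi>), fst (t (snd (t \<xi>))), c (snd (t (snd (t \<xi>)))))" for \<xi>
  have g: "\<exists>\<xi>. g \<xi> = (\<gamma>, \<beta>, n)" for \<gamma> \<beta> n
  proof -
    obtain \<nu> where "c \<nu> = n" using c by (metis surjD)
    moreover obtain \<xi>' where "t \<xi>' = (\<beta>, \<nu>)" using t by (metis surjD)
    moreover obtain \<xi> where "t \<xi> = (\<gamma>, \<xi>')" using t by (metis surjD)
    ultimately show ?thesis by (intro exI[of _ \<xi>]) (simp add: g_def)
  qed
  define P where "P h \<xi> x \<longleftrightarrow> (\<forall>\<xi>'<\<xi>. x \<noteq> h \<xi>') \<and>
    (case g \<xi> of (\<gamma>, \<beta>, n) \<Rightarrow> uncountable (X \<gamma> \<beta>) \<longrightarrow> x \<in> X \<gamma> \<beta>)" for h \<xi> x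
  have "\<exists>h. \<forall>\<xi>. P h \<xi> (h \<xi>)"
  proof (rule dependent_wellorder_choice)
    show "P f \<xi> x = P f' \<xi> x" if "\<And>y. y < \<xi> \<Longrightarrow> f y = f' y" for x f f' \<xi>
      using that by (simp add: P_def)
    fix \<xi> and h :: "omega1 \<Rightarrow> omega1"
    obtain \<gamma> \<beta> n where gx: "g \<xi> = (\<gamma>, \<beta>, n)" by (cases "g \<xi>") auto
    define A where "A = (if uncountable (X \<gamma> \<beta>) then X \<gamma> \<beta> else UNIV)"
    have "uncountable (A - h ` {..<\<xi>})"
      using uncountable_omega1 countable_lessThan_omega1[of \<xi>]
      by (intro uncountable_minus_countable) (auto simp: A_def)
    then obtain x where "x \<in> A - h ` {..<\<xi>}" by (metis countable_empty all_not_in_conv)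
    then show "\<exists>x. P h \<xi> x" unfolding P_def gx by (intro exI[of _ x]) (auto simp: A_def)
  qed
  then obtain h where h: "\<And>\<xi>. P h \<xi> (h \<xi>)" by blast
  have "inj h"
  proof (rule injI, rule ccontr)
    fix \<xi> \<xi>' assume "h \<xi> = h \<xi>'" "\<xi> \<noteq> \<xi>'"
    then show False using h[of \<xi>] h[of \<xi>'] unfolding P_def by (metis linorder_neqE)
  qed
  define f where "f x = snd (snd (g (inv h x)))" for x
  have "\<exists>x\<in>X \<gamma> \<beta>. n \<le> f x" if "uncountable (X \<gamma> \<beta>)" for \<gamma> \<beta> n
  proof -
    obtain \<xi> where \<xi>: "g \<xi> = (\<gamma>, \<beta>, n)" using g by blast
    then have "h \<xi> \<in> X \<gamma> \<beta>" using h[of \<xi>] that by (simp add: P_def)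
    moreover have "f (h \<xi>) = n" using \<xi> \<open>inj h\<close> by (simp add: f_def)
    ultimately show ?thesis by blast
  qed
  then show ?thesis by blast
qed

theorem theorem5:
  fixes C :: "omega1 \<Rightarrow> omega1 set" and z :: "omega1 \<Rightarrow> complex"
  assumes "C_sequence C"
    and "range z \<subseteq> unit_circle"
    and "rationally_independent z"
    and "special_tree (\<subseteq>\<^sub>m) (moore_tree C z)"
  shows "\<not> Delta_space (moore_space C z)"
proof
  assume Delta: "Delta_space (moore_space C z)"
  interpret moore_points C z
    using assms by unfold_locales
  define cone where "cone \<gamma> \<beta> = {\<delta>. \<forall>\<alpha><\<gamma>. w \<delta> \<alpha> = w \<beta> \<alpha>}" for \<gamma> \<beta>
  obtain f :: "omega1 \<Rightarrow> nat" where f: "\<And>\<gamma> \<beta> n. uncountable (cone \<gamma> \<beta>) \<Longrightarrow> \<exists>\<delta>\<in>cone \<gamma> \<beta>. n \<le> f \<delta>"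
    using ex_unbounded_on_uncountable_sets[of cone] by blast
  define D where "D n = w ` {\<beta>. n \<le> f \<beta>}" for n
  have "\<And>n. D n \<subseteq> topspace (moore_space C z)"
    unfolding topspace_moore_space[OF assms(2)] D_def by auto
  moreover have "decseq D" by (auto simp: decseq_def D_def)
  moreover have "(\<Inter>n. D n) = {}"
  proof (rule equals0I)
    fix y assume y: "y \<in> (\<Inter>n. D n)"
    then obtain \<beta> where \<beta>: "y = w \<beta>" by (auto simp: D_def)
    then have "w \<beta> \<in> D (Suc (f \<beta>))" using y by blast
    then show False by (auto simp: D_def w_inject)
  qed
  ultimately obtain U where U: "\<And>n. openin (moore_space C z) (U n)" "\<And>n. D n \<subseteq> U n" "(\<Inter>n. U n) = {}"
    using Delta unfolding Delta_space_def by metis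
  have "\<exists>s \<epsilon>. finite s \<and> 0 < \<epsilon> \<and>
      (n \<le> f \<beta> \<longrightarrow> (\<forall>\<delta>. (\<forall>\<alpha>\<in>s. norm (w \<delta> \<alpha> - w \<beta> \<alpha>) < \<epsilon>) \<longrightarrow> w \<delta> \<in> U n))" for n \<beta>
  proof (cases "n \<le> f \<beta>")
    case True
    then have "w \<beta> \<in> U n" using U(2)[of n] by (auto simp: D_def)
    then show ?thesis using open_contains_basic[OF U(1)] by blast
  next
    case False
    then show ?thesis by (intro exI[of _ "{}"] exI[of _ 1]) simp
  qed
  then obtain s and \<epsilon> :: "nat \<Rightarrow> omega1 \<Rightarrow> real" where s: "\<And>n \<beta>. finite (s n \<beta>)" and \<epsilon>: "\<And>n \<beta>. 0 < \<epsilon> n \<beta>"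
    and sU: "\<And>n \<beta> \<delta>. n \<le> f \<beta> \<Longrightarrow> (\<forall>\<alpha>\<in>s n \<beta>. norm (w \<delta> \<alpha> - w \<beta> \<alpha>) < \<epsilon> n \<beta>) \<Longrightarrow> w \<delta> \<in> U n"
    by metis
  (* The Lindelof property replaces each U n by a union of countably many basic sets. *)
  have "\<exists>Z\<subseteq>{\<beta>. n \<le> f \<beta>}. countable Z \<and> (\<forall>\<delta>\<in>{\<beta>. n \<le> f \<beta>}. \<exists>\<beta>\<in>Z. \<forall>\<alpha>\<in>s n \<beta>. norm (w \<delta> \<alpha> - w \<beta> \<alpha>) < \<epsilon> n \<beta>)" for n
    using s \<epsilon> by (rule countable_subcover)
  then obtain Z where Z: "\<And>n. Z n \<subseteq> {\<beta>. n \<le> f \<beta>}" "\<And>n. countable (Z n)"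
    "\<And>n \<delta>. n \<le> f \<delta> \<Longrightarrow> \<exists>\<beta>\<in>Z n. \<forall>\<alpha>\<in>s n \<beta>. norm (w \<delta> \<alpha> - w \<beta> \<alpha>) < \<epsilon> n \<beta>"
    by (metis mem_Collect_eq)
  have "countable (\<Union>n. \<Union>\<beta>\<in>Z n. s n \<beta>)" using Z(2) s by (simp add: countable_finite)
  then obtain \<gamma> where \<gamma>: "\<And>\<alpha>. \<alpha> \<in> (\<Union>n. \<Union>\<beta>\<in>Z n. s n \<beta>) \<Longrightarrow> \<alpha> < \<gamma>"
    using countable_bounded_omega1 by metis
  obtain \<beta>0 where \<beta>0: "uncountable (cone \<gamma> \<beta>0)" using uncountable_cone unfolding cone_def by blast
  have "w \<beta>0 \<in> U n" for n
  proof -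
    obtain \<delta> where \<delta>: "\<delta> \<in> cone \<gamma> \<beta>0" "n \<le> f \<delta>" using f[OF \<beta>0] by blast
    then obtain \<beta> where \<beta>: "\<beta> \<in> Z n" "\<forall>\<alpha>\<in>s n \<beta>. norm (w \<delta> \<alpha> - w \<beta> \<alpha>) < \<epsilon> n \<beta>" using Z(3) by blast
    have "w \<delta> \<alpha> = w \<beta>0 \<alpha>" if "\<alpha> \<in> s n \<beta>" for \<alpha>
      using \<gamma>[of \<alpha>] \<beta>(1) that \<delta>(1) by (auto simp: cone_def)
    then have "\<forall>\<alpha>\<in>s n \<beta>. norm (w \<beta>0 \<alpha> - w \<beta> \<alpha>) < \<epsilon> n \<beta>" using \<beta>(2) by simp
    moreover have "n \<le> f \<beta>" using Z(1) \<beta>(1) by auto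
    ultimately show ?thesis by (rule sU[rotated])
  qed
  then show False using U(3) by blast
qed

end
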